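(* Let $d\ge 2$ and $N\ge 2$ be integers. For all $0\le p<1$, the fractal percolation set $E(\omega)\subset\mathbb R^d$ is purely $1$-unrectifiable for $\mathbb P_p$-almost all $\omega\in\Omega$.
   Context: Fractal percolation model. Let $\mathbb N=\{0,1,2,\dots\}$. For $n\in\mathbb N$, let $\mathcal Q_n$ be the collection of closed grid cubes $\prod_{i=1}^d[(l_i-1)N^{-n},l_iN^{-n}]$, $l_i\in\{1,\dots,N^n\}$, of $[0,1]^d$. Let $\Omega=\{0,1\}^{\bigcup_{n\in\mathbb N}\mathcal Q_n}$ (equivalently, the set of $\{0,1\}$-labellings of the vertices of the rooted $N^d$-branching tree), equipped with the completion of the product measure $\mathbb P_p$ under which the coordinates $\omega(Q)$ are independent and each equals $1$ with probability $p$ and $0$ with probability $1-p$. Let $\mathcal C_n(\omega)=\{Q\in\mathcal Q_n\mid\omega(Q)=1\}$ and $$E(\omega)=\bigcap_{n=0}^\infty\ \bigcup_{Q\in\mathcal C_n(\omega)}Q .$$ A set $F\subset\mathbb R^d$ is purely $k$-unrectifiable ($k\in\mathbb N\setminus\{0\}$) if $\mathcal H^k(f(\mathbb R^k)\cap F)=0$ for all Lipschitz maps $f\colon\mathbb R^k\to\mathbb R^d$, where $\mathcal H^k$ is the $k$-dimensional Hausdorff measure. *)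

theory Defs
  imports "HOL-Probability.Probability"
begin

section \<open>Hausdorff measure and pure unrectifiability\<close>

text \<open>
  The summand is \<open>diam(E)^k\<close> with \<open>diam(\<emptyset>)^k = 0\<close> also for \<open>k = 0\<close>, where a nonempty set
  contributes \<open>1\<close>.  No dimensional normalising constant is included.  Boundedness of the covering
  sets has to be required explicitly, because \<^const>\<open>diameter\<close> is unspecified on unbounded sets.
\<close>

definition hausdorff_premeasure :: "nat \<Rightarrow> real \<Rightarrow> 'a::metric_space set \<Rightarrow> ennreal" where
  "hausdorff_premeasure k \<delta> A =
     (INF E \<in> {E :: nat \<Rightarrow> 'a set. A \<subseteq> (\<Union>i. E i) \<and> (\<forall>i. bounded (E i) \<and> diameter (E i) \<le> \<delta>)}.
        \<Sum>i. if E i = {} then 0 else ennreal (diameter (E i) ^ k))"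

definition hausdorff_measure :: "nat \<Rightarrow> 'a::metric_space set \<Rightarrow> ennreal" where
  "hausdorff_measure k A = (SUP \<delta> \<in> {0<..}. hausdorff_premeasure k \<delta> A)"

text \<open>
  The dimension \<open>k \<ge> 1\<close> is given by a finite index type, \<open>k = CARD('k)\<close>; so pure
  \<open>1\<close>-unrectifiability is \<open>purely_unrectifiable TYPE(1)\<close>, with the one-element numeral type \<open>1\<close>.
\<close>

definition purely_unrectifiable :: "'k::finite itself \<Rightarrow> (real ^ 'd) set \<Rightarrow> bool" where
  "purely_unrectifiable _ F \<longleftrightarrow>
     (\<forall>f :: real ^ 'k \<Rightarrow> real ^ 'd.
        (\<exists>L. L-lipschitz_on UNIV f) \<longrightarrow> hausdorff_measure CARD('k) (range f \<inter> F) = 0)"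

section \<open>Fractal percolation\<close>

definition grid_cubes :: "nat \<Rightarrow> nat \<Rightarrow> (real ^ 'd) set set" where
  "grid_cubes N n =
     {cbox (\<chi> i. (real (l i) - 1) / real N ^ n) (\<chi> i. real (l i) / real N ^ n) | l :: 'd \<Rightarrow> nat.
        \<forall>i. l i \<in> {1..N ^ n}}"

text \<open>
  Labels \<open>1\<close> and \<open>0\<close> are \<^const>\<open>True\<close> and \<^const>\<open>False\<close>.  For \<open>N \<ge> 2\<close> cubes of different
  levels have different side lengths, so a cube, as a set, determines its level.
\<close>

definition percolation_measure :: "nat \<Rightarrow> real \<Rightarrow> ((real ^ 'd) set \<Rightarrow> bool) measure" where
  "percolation_measure N p =
     completion (\<Pi>\<^sub>M Q \<in> (\<Union>n. grid_cubes N n). measure_pmf (bernoulli_pmf p))"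

definition chosen_cubes :: "nat \<Rightarrow> ((real ^ 'd) set \<Rightarrow> bool) \<Rightarrow> nat \<Rightarrow> (real ^ 'd) set set" where
  "chosen_cubes N \<omega> n = {Q \<in> grid_cubes N n. \<omega> Q}"

definition percolation_set :: "nat \<Rightarrow> ((real ^ 'd) set \<Rightarrow> bool) \<Rightarrow> (real ^ 'd) set" where
  "percolation_set N \<omega> = (\<Inter>n. \<Union>Q \<in> chosen_cubes N \<omega> n. Q)"

end

theory Submission
  imports Defs
begin

text \<open>
  At almost every parameter \<open>t\<close> of a Lipschitz curve \<open>\<gamma>\<close> with \<open>\<gamma> t \<in> E\<close> and nonzero derivative, \<open>E\<close> comes
  close, relative to the scale, to every point of a segment starting at \<open>\<gamma> t\<close>, at all small scales.
  So at every sufficiently fine level \<open>n\<close> the cell of \<open>\<gamma> t\<close> is the start of a discrete line of \<open>W\<close>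
  positions, far apart compared with the cubes, each of them near a chosen cube of level \<open>n\<close>.  There
  are only polynomially many (in \<open>W\<close>) discrete directions, while a given line has this property with
  probability at most \<open>q ^ W\<close> for some \<open>q < 1\<close>.  Different levels are independent, so for large \<open>W\<close>
  the probability that a chain of nested cells has the property at all its levels decays faster than
  the number of such chains grows.  Hence almost surely no such \<open>t\<close> exists, for all curves at once,
  and the remaining parameters have an image of zero length.
\<close>

section \<open>Differentiability of Lipschitz functions\<close>

text \<open>Slope conditions produce intervals that contain \<open>t\<close> without being centred
  at it. A closed interval is the ball about its midpoint, so the Vitali theorem for balls still
  applies.\<close>

lemma Vitali_covering_intervals:
  fixes S U :: "real set"
  assumes "open U" "S \<subseteq> U"
    and fine: "\<forall>t\<in>S. \<forall>e>0. \<exists>u v. u \<le> t \<and> t \<le> v \<and> u < v \<and> v - u < e \<and> P u v"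
  shows "\<exists>C. countable C \<and> (\<forall>(u, v)\<in>C. u < v \<and> P u v \<and> {u..v} \<subseteq> U) \<and>
    disjoint_family_on (\<lambda>(u, v). {u..v}) C \<and> negligible (S - (\<Union>(u, v)\<in>C. {u..v}))"
proof -
  define K where "K = {(u, v). u < v \<and> P u v \<and> {u..v} \<subseteq> U}"
  let ?a = "\<lambda>(u, v). (u + v) / 2 :: real" and ?r = "\<lambda>(u, v). (v - u) / 2 :: real"
  have cball: "cball (?a i) (?r i) = (case i of (u, v) \<Rightarrow> {u..v})" for i
    by (cases i) (auto simp: cball_eq_atLeastAtMost field_simps)
  have fine': "\<exists>i. i \<in> K \<and> t \<in> cball (?a i) (?r i) \<and> ?r i < e" if t: "t \<in> S" and e: "0 < e" for t e
  proof -
    obtain d where d: "d > 0" "ball t d \<subseteq> U"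
      using assms(1,2) t openE by blast
    obtain u v where uv: "u \<le> t" "t \<le> v" "u < v" "v - u < min d e" "P u v"
      using bspec[OF fine t, THEN spec, of "min d e"] d e by auto
    have "{u..v} \<subseteq> ball t d"
      using uv by (auto simp: dist_real_def)
    with d uv have "(u, v) \<in> K"
      by (auto simp: K_def)
    then show ?thesis
      using uv by (intro exI[of _ "(u, v)"]) (auto simp: dist_real_def abs_if field_simps)
  qed
  have pos: "0 < ?r i" if "i \<in> K" for i
    using that by (auto simp: K_def)
  obtain C where "countable C" "C \<subseteq> K"
    "pairwise (\<lambda>i j. disjnt (cball (?a i) (?r i)) (cball (?a j) (?r j))) C"
    "negligible (S - (\<Union>i\<in>C. cball (?a i) (?r i)))"
    by (rule Vitali_covering_theorem_cballs[of K ?r S ?a, OF pos fine'])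
  then show ?thesis
    unfolding cball
    by (intro exI[of _ C]) (auto simp: K_def disjoint_family_on_def pairwise_def disjnt_def)
qed

lemma emeasure_interval_UN:
  assumes "countable C" "disjoint_family_on (\<lambda>(u, v). {u..v::real}) C" "sets M = sets borel"
  shows "emeasure M (\<Union>(u, v)\<in>C. {u..v}) = (\<integral>\<^sup>+i. emeasure M (case i of (u, v) \<Rightarrow> {u..v}) \<partial>count_space C)"
  using assms by (intro emeasure_UN_countable) (auto split: prod.splits)

text \<open>
  Cover \<open>S\<close> by disjoint intervals of slope at most \<open>q\<close>, and then \<open>S\<close> again by disjoint intervals of
  slope at least \<open>r\<close> inside the first ones: comparing the increments of \<open>F\<close> shrinks the outer
  measure of \<open>S\<close> by the factor \<open>q / r\<close>.
\<close>

lemma negligible_slope_gap: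
  fixes F :: "real \<Rightarrow> real"
  assumes mono: "\<And>x y. x \<le> y \<Longrightarrow> F x \<le> F y" and cont: "continuous_on UNIV F"
    and qr: "0 \<le> q" "q < r" and S: "S \<subseteq> {a..b}"
    and low: "\<And>t e. t \<in> S \<Longrightarrow> 0 < e \<Longrightarrow>
      \<exists>u v. u \<le> t \<and> t \<le> v \<and> u < v \<and> v - u < e \<and> F v - F u \<le> q * (v - u)"
    and up: "\<And>t e. t \<in> S \<Longrightarrow> 0 < e \<Longrightarrow>
      \<exists>u v. u \<le> t \<and> t \<le> v \<and> u < v \<and> v - u < e \<and> r * (v - u) \<le> F v - F u"
  shows "negligible S"
proof -
  \<comment> \<open>\<open>S\<close> is not known to be measurable, so the comparison is made on
    measurable covers: a cover \<open>T\<close> yields another one, smaller by the factor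
    \<open>q / r\<close> up to the slack \<open>d\<close>.\<close>
  have shrink: "\<exists>T'. T' \<in> lmeasurable \<and> S \<subseteq> T' \<and> r * measure lebesgue T' \<le> q * (measure lebesgue T + d)"
    if T: "T \<in> lmeasurable" "S \<subseteq> T" and d: "0 < d" for T d
  proof -
    \<comment> \<open>The Stieltjes measure of \<open>F\<close> turns sums of increments over
      disjoint intervals into the measure of a union, so that nested families compare by
      monotonicity. Continuity of \<open>F\<close> makes closed intervals have mass
      \<open>F v - F u\<close>.\<close>
    let ?\<nu> = "interval_measure F" and ?I = "\<lambda>(u, v). {u..v::real}"
    have \<nu>: "emeasure ?\<nu> {u..v} = ennreal (F v - F u)" if "u \<le> v" for u v
      using that mono cont by (rule emeasure_interval_measure_Icc)
    obtain U where U0: "open U" "T \<subseteq> U" "U - T \<in> lmeasurable" "emeasure lebesgue (U - T) < ennreal d"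
      using sets_lebesgue_outer_open[OF fmeasurableD[OF T(1)] d] by metis
    have Ueq: "U = T \<union> (U - T)"
      using U0 by auto
    have "measure lebesgue (U - T) < d"
      using U0(3,4) d by (simp add: emeasure_eq_measure2 ennreal_less_iff)
    moreover have "measure lebesgue U \<le> measure lebesgue T + measure lebesgue (U - T)"
      using T(1) U0(3) by (subst Ueq, intro measure_Un_le) (auto intro: fmeasurableD)
    moreover have "U \<in> lmeasurable"
      using T(1) U0(3) by (subst Ueq) (rule fmeasurable.Un)
    ultimately have U: "open U" "T \<subseteq> U" "U \<in> lmeasurable" "measure lebesgue U < measure lebesgue T + d"
      using U0 by auto
    have "\<forall>t\<in>S. \<forall>e>0. \<exists>u v. u \<le> t \<and> t \<le> v \<and> u < v \<and> v - u < e \<and> F v - F u \<le> q * (v - u)"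
      using low by simp
    from Vitali_covering_intervals[OF U(1) subset_trans[OF T(2) U(2)] this]
    obtain C where C: "countable C" "\<forall>(u, v)\<in>C. u < v \<and> F v - F u \<le> q * (v - u) \<and> {u..v} \<subseteq> U"
        "disjoint_family_on ?I C" "negligible (S - (\<Union>i\<in>C. ?I i))"
      by (elim exE conjE)
    \<comment> \<open>The second Vitali family has to live in an open set inside the first one.
      Passing to open intervals loses only countably many endpoints.\<close>
    define V where "V = (\<Union>(u, v)\<in>C. {u<..<v})"
    have V: "open V" "V \<subseteq> (\<Union>i\<in>C. ?I i)"
      unfolding V_def by (auto intro!: open_UN UN_mono split: prod.splits)
    have "\<forall>t\<in>S \<inter> V. \<forall>e>0. \<exists>u v. u \<le> t \<and> t \<le> v \<and> u < v \<and> v - u < e \<and> r * (v - u) \<le> F v - F u"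
      using up by simp
    from Vitali_covering_intervals[OF V(1) Int_lower2 this]
    obtain D where D: "countable D" "\<forall>(u, v)\<in>D. u < v \<and> r * (v - u) \<le> F v - F u \<and> {u..v} \<subseteq> V"
        "disjoint_family_on ?I D" "negligible (S \<inter> V - (\<Union>i\<in>D. ?I i))"
      by (elim exE conjE)
    define Cs where "Cs = (\<Union>i\<in>C. ?I i)"
    define Ds where "Ds = (\<Union>i\<in>D. ?I i)"
    have borel: "Ds \<in> sets borel" "Cs \<in> sets borel" "V \<in> sets borel"
      using C(1) D(1) V(1) by (auto simp: Cs_def Ds_def)
    have CU: "Cs \<subseteq> U"
      using C(2) unfolding Cs_def by fastforce
    have DV: "Ds \<subseteq> V"
      using D(2) unfolding Ds_def by fastforce
    have "ennreal r * emeasure lborel Ds = (\<integral>\<^sup>+i. ennreal r * emeasure lborel (?I i) \<partial>count_space D)"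
      using D unfolding Ds_def by (subst emeasure_interval_UN) (auto simp: nn_integral_cmult)
    also have "\<dots> \<le> (\<integral>\<^sup>+i. emeasure ?\<nu> (?I i) \<partial>count_space D)"
    proof (rule nn_integral_mono)
      fix i assume "i \<in> space (count_space D)"
      then obtain u v where "i = (u, v)" "u < v" "r * (v - u) \<le> F v - F u"
        using D(2) by (cases i) auto
      then show "ennreal r * emeasure lborel (?I i) \<le> emeasure ?\<nu> (?I i)"
        using qr by (simp add: \<nu> ennreal_mult[symmetric] ennreal_leI)
    qed
    also have "\<dots> = emeasure ?\<nu> Ds"
      using D unfolding Ds_def by (subst emeasure_interval_UN) auto
    also have "\<dots> \<le> emeasure ?\<nu> Cs"
      using DV V borel by (intro emeasure_mono) (auto simp: Cs_def)
    also have "\<dots> = (\<integral>\<^sup>+i. emeasure ?\<nu> (?I i) \<partial>count_space C)"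
      using C unfolding Cs_def by (subst emeasure_interval_UN) auto
    also have "\<dots> \<le> (\<integral>\<^sup>+i. ennreal q * emeasure lborel (?I i) \<partial>count_space C)"
    proof (rule nn_integral_mono)
      fix i assume "i \<in> space (count_space C)"
      then obtain u v where "i = (u, v)" "u < v" "F v - F u \<le> q * (v - u)"
        using C(2) by (cases i) auto
      then show "emeasure ?\<nu> (?I i) \<le> ennreal q * emeasure lborel (?I i)"
        using qr by (simp add: \<nu> ennreal_mult[symmetric] ennreal_leI)
    qed
    also have "\<dots> = ennreal q * emeasure lborel Cs"
      using C unfolding Cs_def by (subst emeasure_interval_UN) (auto simp: nn_integral_cmult)
    finally have main: "ennreal r * emeasure lborel Ds \<le> ennreal q * emeasure lborel Cs" .
    have "countable (Cs - V)"
    proof (rule countable_subset)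
      show "Cs - V \<subseteq> fst ` C \<union> snd ` C"
      proof
        fix t assume "t \<in> Cs - V"
        then obtain u v where "(u, v) \<in> C" "u \<le> t" "t \<le> v" "\<not> (u < t \<and> t < v)"
          by (force simp: Cs_def V_def)
        then show "t \<in> fst ` C \<union> snd ` C"
          by (force simp: image_iff)
      qed
    qed (use C(1) in auto)
    then have nCV: "negligible (Cs - V)"
      by (simp add: negligible_iff_null_sets null_sets_completionI countable_imp_null_set_lborel)
    \<comment> \<open>What the first family misses, the lost endpoints, and what the second family
      misses.\<close>
    define N where "N = (S - Cs) \<union> (Cs - V) \<union> (S \<inter> V - Ds)"
    have N: "negligible N"
      using C(4) D(4) nCV unfolding N_def Cs_def Ds_def by (intro negligible_Un)
    have SN: "S \<subseteq> Ds \<union> N"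
      by (auto simp: N_def)
    have "Cs \<in> sets lebesgue" "Ds \<in> sets lebesgue"
      using borel by auto
    moreover have "Ds \<subseteq> U"
      using CU DV V(2) unfolding Cs_def by (metis subset_trans)
    ultimately have lm: "Cs \<in> lmeasurable" "Ds \<in> lmeasurable"
      using CU by (auto intro: fmeasurableI2[OF U(3)])
    have "emeasure lborel A = ennreal (measure lebesgue A)" if "A \<in> lmeasurable" "A \<in> sets borel" for A :: "real set"
      using that(2) by (subst emeasure_eq_measure2[OF that(1), symmetric]) simp
    then have "ennreal (r * measure lebesgue Ds) \<le> ennreal (q * measure lebesgue Cs)"
      using main qr lm borel by (simp add: ennreal_mult)
    then have 1: "r * measure lebesgue Ds \<le> q * measure lebesgue Cs"
      using qr by (simp add: ennreal_le_iff)
    have 2: "measure lebesgue Cs \<le> measure lebesgue U"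
      using CU lm U(3) by (intro measure_mono_fmeasurable) auto
    have "measure lebesgue (Ds \<union> N) = measure lebesgue Ds"
      using N lm(2) by (intro measure_Un_null_set) (auto simp: negligible_iff_null_sets)
    moreover have "Ds \<union> N \<in> lmeasurable"
      using lm(2) negligible_imp_measurable[OF N] by (rule fmeasurable.Un)
    moreover have "q * measure lebesgue Cs \<le> q * (measure lebesgue T + d)"
      using 2 U(4) qr by (intro mult_left_mono) auto
    ultimately show ?thesis
      using 1 SN by (intro exI[of _ "Ds \<union> N"]) auto
  qed
  \<comment> \<open>The outer measure of \<open>S\<close>, finite because \<open>S\<close> is
    bounded. Letting the slack tend to \<open>0\<close> gives \<open>r * m \<le> q * m\<close>,
    which forces \<open>m = 0\<close>.\<close>
  define m where "m = (INF T\<in>{T. T \<in> lmeasurable \<and> S \<subseteq> T}. measure lebesgue T)"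
  have ne: "{T. T \<in> lmeasurable \<and> S \<subseteq> T} \<noteq> {}"
    using S by (auto intro!: exI[of _ "{a..b}"])
  have bdd: "bdd_below (measure lebesgue ` {T. T \<in> lmeasurable \<and> S \<subseteq> T})"
    by (intro bdd_belowI[of _ 0]) auto
  have m0: "0 \<le> m"
    unfolding m_def using ne by (intro cINF_greatest) auto
  have rm: "r * m \<le> q * (m + 2 * d)" if d: "d > 0" for d
  proof -
    obtain T where T: "T \<in> lmeasurable" "S \<subseteq> T" "measure lebesgue T < m + d"
      using cINF_less_iff[OF ne bdd, of "m + d"] d unfolding m_def[symmetric] by auto
    obtain T' where T': "T' \<in> lmeasurable" "S \<subseteq> T'" "r * measure lebesgue T' \<le> q * (measure lebesgue T + d)"
      using shrink[OF T(1,2) d] by blast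
    have "m \<le> measure lebesgue T'"
      unfolding m_def using bdd T' by (intro cINF_lower) auto
    then have "r * m \<le> r * measure lebesgue T'"
      using qr by simp
    also have "\<dots> \<le> q * (m + 2 * d)"
      using T'(3) T(3) qr by (smt (verit) mult_left_mono)
    finally show ?thesis .
  qed
  have "m = 0"
  proof (rule ccontr)
    assume "m \<noteq> 0"
    with m0 have "m > 0" by simp
    have "((\<lambda>d. q * (m + 2 * d)) \<longlongrightarrow> q * (m + 2 * 0)) (at_right 0)"
      by (intro tendsto_intros)
    then have "r * m \<le> q * (m + 2 * 0)"
      by (rule tendsto_lowerbound) (auto simp: eventually_at_filter rm)
    with \<open>m > 0\<close> qr show False by simp
  qed
  show ?thesis
    unfolding negligible_outer_le
  proof (intro allI impI)
    fix e :: real assume "e > 0"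
    then obtain T where "T \<in> lmeasurable" "S \<subseteq> T" "measure lebesgue T < e"
      using cINF_less_iff[OF ne bdd, of e] \<open>m = 0\<close> unfolding m_def[symmetric] by auto
    then show "\<exists>T. S \<subseteq> T \<and> T \<in> lmeasurable \<and> measure lebesgue T \<le> e"
      by (auto intro: less_imp_le)
  qed
qed

text \<open>Adding \<open>L * t\<close> makes the function monotone, with slopes between
  \<open>0\<close> and \<open>2 * L\<close>. If the lower and upper limits of the difference
  quotient differ at a point, rationals \<open>q < r\<close> separate them, and the point lies in
  one of countably many sets covered by \<open>negligible_slope_gap\<close>. Elsewhere the slope
  bounds make the common limit finite.\<close>

lemma lipschitz_differentiable_ae:
  fixes f :: "real \<Rightarrow> real"
  assumes L: "L-lipschitz_on UNIV f"
  shows "negligible {t. \<not> f differentiable at t}"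
proof -
  define F where "F t = f t + L * t" for t
  have lip: "\<bar>f x - f y\<bar> \<le> L * \<bar>x - y\<bar>" for x y
    using lipschitz_onD[OF L, of x y] by (simp add: dist_real_def)
  have mono: "F x \<le> F y" if "x \<le> y" for x y
    using lip[of x y] that by (auto simp: F_def abs_if field_simps split: if_splits)
  have cont: "continuous_on UNIV F"
    unfolding F_def using lipschitz_on_continuous_on[OF L] by (intro continuous_intros)
  define low where "low q t \<longleftrightarrow>
    (\<forall>e>0. \<exists>u v. u \<le> t \<and> t \<le> v \<and> u < v \<and> v - u < e \<and> F v - F u \<le> q * (v - u))" for q t
  define up where "up r t \<longleftrightarrow>
    (\<forall>e>0. \<exists>u v. u \<le> t \<and> t \<le> v \<and> u < v \<and> v - u < e \<and> r * (v - u) \<le> F v - F u)" for r t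
  define S where "S n q r = {t \<in> {- real n..real n}. low q t \<and> up r t}" for n q r
  define I where "I = {(n :: nat, q :: real, r :: real). q \<in> \<rat> \<and> r \<in> \<rat> \<and> 0 \<le> q \<and> q < r}"
  have "countable (UNIV \<times> \<rat> \<times> \<rat> :: (nat \<times> real \<times> real) set)"
    by (intro countable_SIGMA countable_rat) auto
  then have cI: "countable I"
    by (rule countable_subset[rotated]) (auto simp: I_def)
  have "negligible (S n q r)" if "(n, q, r) \<in> I" for n q r
    using that by (intro negligible_slope_gap[of F q r _ "- real n" "real n"])
      (auto simp: S_def I_def low_def up_def intro: mono cont)
  then have neg: "negligible (\<Union>(n, q, r)\<in>I. S n q r)"
    using cI by (intro negligible_countable_Union) auto
  have "f differentiable at t" if t: "t \<notin> (\<Union>(n, q, r)\<in>I. S n q r)" for t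
  proof -
    define \<phi> where "\<phi> h = (F (t + h) - F t) / h" for h
    \<comment> \<open>Ordering the two points turns a quotient with \<open>h\<close> of either sign
      into the slope over an interval containing \<open>t\<close>, the form used in
      \<open>low\<close> and \<open>up\<close>.\<close>
    have slope: "\<phi> h = (F (max t (t + h)) - F (min t (t + h))) / (max t (t + h) - min t (t + h))"
      if "h \<noteq> 0" for h
      using that by (cases "h > 0") (auto simp: \<phi>_def field_simps)
    have bounds: "0 \<le> \<phi> h" "\<phi> h \<le> 2 * L" if "h \<noteq> 0" for h
    proof -
      have "F (max t (t + h)) - F (min t (t + h)) \<le> 2 * L * (max t (t + h) - min t (t + h))"
        using lip[of "max t (t + h)" "min t (t + h)"] by (auto simp: F_def algebra_simps)
      then show "0 \<le> \<phi> h" "\<phi> h \<le> 2 * L"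
        unfolding slope[OF that] using that mono[of "min t (t + h)" "max t (t + h)"]
        by (auto simp: divide_simps split: if_splits)
    qed
    let ?l = "Liminf (at 0) (\<lambda>h. ereal (\<phi> h))" and ?u = "Limsup (at 0) (\<lambda>h. ereal (\<phi> h))"
    have l0: "0 \<le> ?l"
      by (rule Liminf_bounded) (auto simp: eventually_at_filter bounds)
    have u2: "?u \<le> ereal (2 * L)"
      by (rule Limsup_bounded) (auto simp: eventually_at_filter bounds)
    have lu: "?l \<le> ?u"
      by (rule Liminf_le_Limsup) simp
    have "\<not> ?l < ?u"
    proof
      assume "?l < ?u"
      then obtain r' where r': "?l < real_of_rat r'" "real_of_rat r' < ?u"
        using ereal_dense3 by blast
      obtain q' where q': "?l < real_of_rat q'" "ereal (real_of_rat q') < real_of_rat r'"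
        using ereal_dense3[OF r'(1)] by blast
      define q r where "q = real_of_rat q'" and "r = real_of_rat r'"
      have "0 < ereal q"
        using l0 q'(1) unfolding q_def by (rule le_less_trans)
      then have qr: "q \<in> \<rat>" "r \<in> \<rat>" "0 \<le> q" "q < r" "?l < ereal q" "ereal r < ?u"
        using q' r' by (simp_all add: q_def r_def)
      have "low q t"
        unfolding low_def
      proof (intro allI impI)
        fix e :: real assume "e > 0"
        have "\<not> eventually (\<lambda>h. q < \<phi> h) (at 0)"
        proof
          assume "eventually (\<lambda>h. q < \<phi> h) (at 0)"
          then have "ereal q \<le> ?l"
            by (intro Liminf_bounded) (auto elim!: eventually_mono)
          with qr(5) show False by simp
        qed
        then obtain h where h: "h \<noteq> 0" "\<bar>h\<bar> < e" "\<phi> h \<le> q"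
          using \<open>e > 0\<close> by (auto simp: eventually_at dist_real_def not_less dest!: spec[of _ e])
        then show "\<exists>u v. u \<le> t \<and> t \<le> v \<and> u < v \<and> v - u < e \<and> F v - F u \<le> q * (v - u)"
          by (intro exI[of _ "min t (t + h)"] exI[of _ "max t (t + h)"])
             (auto simp: slope divide_simps split: if_splits)
      qed
      moreover have "up r t"
        unfolding up_def
      proof (intro allI impI)
        fix e :: real assume "e > 0"
        have "\<not> eventually (\<lambda>h. \<phi> h < r) (at 0)"
        proof
          assume "eventually (\<lambda>h. \<phi> h < r) (at 0)"
          then have "?u \<le> ereal r"
            by (intro Limsup_bounded) (auto elim!: eventually_mono)
          with qr(6) show False by simp
        qed
        then obtain h where h: "h \<noteq> 0" "\<bar>h\<bar> < e" "r \<le> \<phi> h"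
          using \<open>e > 0\<close> by (auto simp: eventually_at dist_real_def not_less dest!: spec[of _ e])
        then show "\<exists>u v. u \<le> t \<and> t \<le> v \<and> u < v \<and> v - u < e \<and> r * (v - u) \<le> F v - F u"
          by (intro exI[of _ "min t (t + h)"] exI[of _ "max t (t + h)"])
             (auto simp: slope divide_simps split: if_splits)
      qed
      moreover obtain n where "\<bar>t\<bar> \<le> real n"
        using real_arch_simple by blast
      ultimately have "t \<in> S n q r" "(n, q, r) \<in> I"
        using qr by (auto simp: S_def I_def)
      with t show False by auto
    qed
    with lu have eq: "?l = ?u" by simp
    have "\<bar>?l\<bar> \<noteq> \<infinity>"
      using l0 u2 eq by auto
    then obtain l where l: "?l = ereal l"
      by (cases ?l) auto
    then have "((\<lambda>h. ereal (\<phi> h)) \<longlongrightarrow> ereal l) (at 0)"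
      using eq by (subst tendsto_iff_Liminf_eq_Limsup) auto
    then have "(\<phi> \<longlongrightarrow> l) (at 0)"
      by simp
    then have "(F has_field_derivative l) (at t)"
      by (simp add: DERIV_def \<phi>_def[abs_def])
    then have "((\<lambda>x. F x - L * x) has_field_derivative l - L) (at t)"
      by (auto intro!: derivative_eq_intros)
    then have "(f has_field_derivative l - L) (at t)"
      by (simp add: F_def)
    then show ?thesis
      using real_differentiable_def by blast
  qed
  then show ?thesis
    by (intro negligible_subset[OF neg]) blast
qed

section \<open>Hausdorff measure of images of real sets\<close>

text \<open>The covers below are indexed by pairs or by sets of intervals, while the premeasure asks
  for sequences. Enumerating the indices and padding with empty sets costs nothing, since
  \<open>{}\<close> has weight \<open>0\<close>.\<close>

lemma hausdorff_premeasure_le_cover: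
  fixes E :: "'i \<Rightarrow> 'a::metric_space set"
  assumes I: "countable I" and A: "A \<subseteq> (\<Union>i\<in>I. E i)" and "0 \<le> \<delta>"
    and E: "\<And>i. i \<in> I \<Longrightarrow> bounded (E i) \<and> diameter (E i) \<le> \<delta>"
  shows "hausdorff_premeasure k \<delta> A
    \<le> (\<integral>\<^sup>+i. (if E i = {} then 0 else ennreal (diameter (E i) ^ k)) \<partial>count_space I)"
proof -
  let ?w = "\<lambda>S. if S = {} then 0 else ennreal (diameter S ^ k)"
  define J where "J = to_nat_on I ` I"
  define E' where "E' n = (if n \<in> J then E (from_nat_into I n) else {})" for n
  have bij: "bij_betw (to_nat_on I) I J"
    using I by (simp add: J_def inj_on_imp_bij_betw inj_on_to_nat_on)
  have E'E: "E' (to_nat_on I i) = E i" if "i \<in> I" for i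
    using that I by (auto simp: E'_def J_def)
  have "A \<subseteq> (\<Union>n. E' n)"
  proof
    fix x assume "x \<in> A"
    then obtain i where "i \<in> I" "x \<in> E i" using A by auto
    then show "x \<in> (\<Union>n. E' n)"
      using E'E by blast
  qed
  moreover have "bounded (E' n) \<and> diameter (E' n) \<le> \<delta>" for n
    using E \<open>0 \<le> \<delta>\<close> I by (auto simp: E'_def J_def)
  ultimately have "hausdorff_premeasure k \<delta> A \<le> (\<Sum>n. ?w (E' n))"
    unfolding hausdorff_premeasure_def by (intro INF_lower) auto
  also have "\<dots> = (\<integral>\<^sup>+n. ?w (E' n) \<partial>count_space UNIV)"
    by (simp add: nn_integral_count_space_nat)
  also have "\<dots> = (\<integral>\<^sup>+n. ?w (E' n) \<partial>count_space J)"
    by (rule nn_integral_count_space_eq) (auto simp: E'_def)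
  also have "\<dots> = (\<integral>\<^sup>+i. ?w (E' (to_nat_on I i)) \<partial>count_space I)"
    using nn_integral_bij_count_space[OF bij, of "\<lambda>n. ?w (E' n)"] by simp
  also have "\<dots> = (\<integral>\<^sup>+i. ?w (E i) \<partial>count_space I)"
    by (rule nn_integral_cong) (simp add: E'E)
  finally show ?thesis .
qed

lemma hausdorff_measure_mono:
  assumes "A \<subseteq> B"
  shows "hausdorff_measure k A \<le> hausdorff_measure k B"
  unfolding hausdorff_measure_def hausdorff_premeasure_def
  using assms by (intro SUP_mono' INF_superset_mono) auto

lemma hausdorff_measure_eq_0I:
  assumes "\<And>\<delta> e. 0 < \<delta> \<Longrightarrow> 0 < e \<Longrightarrow> hausdorff_premeasure k \<delta> A \<le> ennreal e"
  shows "hausdorff_measure k A = 0"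
proof -
  have "hausdorff_premeasure k \<delta> A \<le> 0" if "0 < \<delta>" for \<delta>
    by (rule ennreal_le_epsilon) (simp add: assms that)
  then have "hausdorff_measure k A \<le> 0"
    unfolding hausdorff_measure_def by (intro SUP_least) simp
  then show ?thesis by simp
qed

lemma hausdorff_measure_UN_null:
  fixes A :: "nat \<Rightarrow> 'a::metric_space set"
  assumes "\<And>n. hausdorff_measure k (A n) = 0"
  shows "hausdorff_measure k (\<Union>n. A n) = 0"
proof (rule hausdorff_measure_eq_0I)
  let ?w = "\<lambda>S :: 'a set. if S = {} then 0 else ennreal (diameter S ^ k)"
  show "hausdorff_premeasure k \<delta> (\<Union>n. A n) \<le> ennreal e" if \<delta>: "0 < \<delta>" and e: "0 < e" for \<delta> e
  proof -
    have "\<exists>E. \<forall>n. A n \<subseteq> (\<Union>i. E n i) \<and> (\<forall>i. bounded (E n i) \<and> diameter (E n i) \<le> \<delta>) \<and>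
        (\<Sum>i :: nat. ?w (E n i)) \<le> ennreal (e * (1 / 2) ^ Suc n)"
    proof (intro choice allI)
      fix n
      have "hausdorff_premeasure k \<delta> (A n) \<le> hausdorff_measure k (A n)"
        unfolding hausdorff_measure_def using \<delta> by (intro SUP_upper) auto
      then have "hausdorff_premeasure k \<delta> (A n) < ennreal (e * (1 / 2) ^ Suc n)"
        using assms[of n] e by simp
      then show "\<exists>E. A n \<subseteq> (\<Union>i. E i) \<and> (\<forall>i. bounded (E i) \<and> diameter (E i) \<le> \<delta>) \<and>
        (\<Sum>i :: nat. ?w (E i)) \<le> ennreal (e * (1 / 2) ^ Suc n)"
        unfolding hausdorff_premeasure_def INF_less_iff by (auto intro: less_imp_le)
    qed
    then obtain E where "\<forall>n. A n \<subseteq> (\<Union>i. E n i) \<and> (\<forall>i. bounded (E n i) \<and> diameter (E n i) \<le> \<delta>) \<and>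
        (\<Sum>i :: nat. ?w (E n i)) \<le> ennreal (e * (1 / 2) ^ Suc n)"
      by (elim exE)
    then have E: "\<And>n. A n \<subseteq> (\<Union>i. E n i)" "\<And>n i. bounded (E n i) \<and> diameter (E n i) \<le> \<delta>"
      "\<And>n. (\<Sum>i :: nat. ?w (E n i)) \<le> ennreal (e * (1 / 2) ^ Suc n)"
      by simp_all
    have "(\<Union>n. A n) \<subseteq> (\<Union>ni. E (fst ni) (snd ni))"
      using E(1) by fastforce
    then have "hausdorff_premeasure k \<delta> (\<Union>n. A n)
        \<le> (\<integral>\<^sup>+ni. ?w (E (fst ni) (snd ni)) \<partial>count_space (UNIV :: (nat \<times> nat) set))"
      using E(2) \<delta> by (intro hausdorff_premeasure_le_cover) auto
    also have "\<dots> = (\<integral>\<^sup>+n. \<integral>\<^sup>+i. ?w (E n i) \<partial>count_space UNIV \<partial>count_space UNIV)"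
      by (subst nn_integral_fst_count_space[symmetric]) (simp only: fst_conv snd_conv)
    also have "\<dots> = (\<Sum>n. \<Sum>i. ?w (E n i))"
      by (simp add: nn_integral_count_space_nat)
    also have "\<dots> \<le> (\<Sum>n. ennreal (e * (1 / 2) ^ Suc n))"
      using E(3) by (intro suminf_le) auto
    also have "\<dots> = ennreal e"
    proof (rule suminf_ennreal_eq)
      show "(\<lambda>n. e * (1 / 2) ^ Suc n) sums e"
        using sums_mult[OF power_half_series, of e] by simp
    qed (use e in auto)
    finally show ?thesis by simp
  qed
qed

text \<open>Cover \<open>S\<close> by nonoverlapping intervals inside \<open>U\<close>, each so
  short that the estimate at one of its own points of \<open>S\<close> holds throughout. The image
  of such an interval has diameter at most \<open>2 * c\<close> times its length, and the lengths
  add up to at most the measure of \<open>U\<close>. The two applications make \<open>c\<close>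
  small and \<open>U\<close> small, respectively.\<close>

lemma hausdorff_premeasure_image_le:
  fixes f :: "real \<Rightarrow> 'a::metric_space"
  assumes S: "S \<subseteq> {a..b}" and U: "open U" "S \<subseteq> U" and "0 \<le> c" "0 < \<delta>"
    and f: "\<And>t. t \<in> S \<Longrightarrow> \<exists>h>0. \<forall>s. \<bar>s - t\<bar> < h \<longrightarrow> dist (f s) (f t) \<le> c * \<bar>s - t\<bar>"
  shows "hausdorff_premeasure 1 \<delta> (f ` S) \<le> ennreal (2 * c) * emeasure lborel U"
proof -
  \<comment> \<open>An interval inside a ball of radius \<open>d\<close> has length below
    \<open>2 * d\<close>, hence an image of diameter at most
    \<open>4 * c * d \<le> \<delta>\<close>. The added \<open>1\<close> guards against
    \<open>c = 0\<close>.\<close>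
  have "\<forall>t\<in>S. \<exists>d>0. ball t d \<subseteq> U \<and> d \<le> \<delta> / (4 * c + 1) \<and>
      (\<forall>s. \<bar>s - t\<bar> < d \<longrightarrow> dist (f s) (f t) \<le> c * \<bar>s - t\<bar>)"
  proof
    fix t assume t: "t \<in> S"
    obtain h where "h > 0" "\<forall>s. \<bar>s - t\<bar> < h \<longrightarrow> dist (f s) (f t) \<le> c * \<bar>s - t\<bar>"
      using f[OF t] by blast
    moreover obtain e where "e > 0" "ball t e \<subseteq> U"
      using U t openE by blast
    ultimately show "\<exists>d>0. ball t d \<subseteq> U \<and> d \<le> \<delta> / (4 * c + 1) \<and>
      (\<forall>s. \<bar>s - t\<bar> < d \<longrightarrow> dist (f s) (f t) \<le> c * \<bar>s - t\<bar>)"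
      using \<open>0 \<le> c\<close> \<open>0 < \<delta>\<close> by (intro exI[of _ "min (min h e) (\<delta> / (4 * c + 1))"]) auto
  qed
  from bchoice[OF this] obtain d where "\<forall>t\<in>S. 0 < d t \<and> ball t (d t) \<subseteq> U \<and> d t \<le> \<delta> / (4 * c + 1) \<and>
      (\<forall>s. \<bar>s - t\<bar> < d t \<longrightarrow> dist (f s) (f t) \<le> c * \<bar>s - t\<bar>)"
    by (elim exE)
  then have d: "\<And>t. t \<in> S \<Longrightarrow> 0 < d t" "\<And>t. t \<in> S \<Longrightarrow> ball t (d t) \<subseteq> U"
    "\<And>t. t \<in> S \<Longrightarrow> d t \<le> \<delta> / (4 * c + 1)"
    "\<And>t s. t \<in> S \<Longrightarrow> \<bar>s - t\<bar> < d t \<Longrightarrow> dist (f s) (f t) \<le> c * \<bar>s - t\<bar>"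
    by auto
  \<comment> \<open>A gauge assigns a neighbourhood to every real, but the tags of the covering lie
    in \<open>S\<close>; the radius \<open>1\<close> elsewhere is arbitrary.\<close>
  define g where "g t = ball t (if t \<in> S then d t else 1)" for t
  have g: "gauge g"
    using d(1) by (auto simp: gauge_def g_def)
  \<comment> \<open>The interval is enlarged so that it has nonempty interior for all
    \<open>a\<close> and \<open>b\<close>, as \<open>covering_lemma\<close> demands.\<close>
  have sub: "S \<subseteq> cbox (a - 1) (max a b)"
    using S by (auto simp: cbox_interval)
  have ne: "box (a - 1) (max a b) \<noteq> {}"
    by (simp add: box_real)
  obtain \<D> where \<D>: "countable \<D>" "\<And>K. K \<in> \<D> \<Longrightarrow> interior K \<noteq> {} \<and> (\<exists>c d. K = cbox c d)"
      "pairwise (\<lambda>A B. interior A \<inter> interior B = {}) \<D>"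
      "\<And>K. K \<in> \<D> \<Longrightarrow> \<exists>x \<in> S \<inter> K. K \<subseteq> g x" "S \<subseteq> \<Union>\<D>"
  proof (rule covering_lemma[OF sub ne g])
    fix \<D> :: "real set set"
    assume "countable \<D>" "\<And>K. K \<in> \<D> \<Longrightarrow> interior K \<noteq> {} \<and> (\<exists>c d. K = cbox c d)"
      "pairwise (\<lambda>A B. interior A \<inter> interior B = {}) \<D>"
      "\<And>K. K \<in> \<D> \<Longrightarrow> \<exists>x \<in> S \<inter> K. K \<subseteq> g x" "S \<subseteq> \<Union>\<D>"
    then show thesis by (rule that)
  qed
  have K: "bounded (f ` K) \<and> diameter (f ` K) \<le> \<delta> \<and> interior K \<subseteq> U \<and>
      (if f ` K = {} then 0 else ennreal (diameter (f ` K) ^ 1)) \<le> ennreal (2 * c) * emeasure lborel (interior K)"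
    if KD: "K \<in> \<D>" for K
  proof -
    obtain u v where K: "K = {u..v}" "u < v"
      using \<D>(2)[OF KD] by (auto simp: cbox_interval)
    obtain t where t: "t \<in> S" "u \<le> t" "t \<le> v" "K \<subseteq> ball t (d t)"
      using \<D>(4)[OF KD] K by (auto simp: g_def split: if_splits)
    have near: "dist (f s) (f t) \<le> c * \<bar>s - t\<bar>" if "s \<in> K" for s
      using t that by (intro d(4)) (auto simp: dist_real_def subset_iff abs_minus_commute)
    have diam: "dist (f x) (f y) \<le> 2 * c * (v - u)" if "x \<in> K" "y \<in> K" for x y
    proof -
      have "dist (f x) (f y) \<le> c * (\<bar>x - t\<bar> + \<bar>y - t\<bar>)"
        using near[OF that(1)] near[OF that(2)] dist_triangle2[of "f x" "f y" "f t"]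
        by (simp add: algebra_simps)
      also have "\<dots> \<le> c * (2 * (v - u))"
        using \<open>0 \<le> c\<close> t that K by (intro mult_left_mono) auto
      finally show ?thesis by (simp add: algebra_simps)
    qed
    have bdd: "bounded (f ` K)"
      unfolding bounded_def using diam t K
      by (intro exI[of _ "f t"] exI[of _ "2 * c * (v - u)"]) auto
    have "v - u < 2 * d t"
    proof -
      have "u \<in> ball t (d t)" "v \<in> ball t (d t)"
        using K subsetD[OF t(4), of u] subsetD[OF t(4), of v] by simp_all
      then show ?thesis by (auto simp: dist_real_def)
    qed
    then have "2 * c * (v - u) \<le> 2 * c * (2 * d t)"
      using \<open>0 \<le> c\<close> by (intro mult_left_mono) auto
    also have "\<dots> \<le> (4 * c + 1) * d t"
      using d(1)[OF t(1)] by (simp add: algebra_simps)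
    also have "\<dots> \<le> \<delta>"
      using d(3)[OF t(1)] \<open>0 \<le> c\<close> by (simp add: field_simps)
    finally have small: "2 * c * (v - u) \<le> \<delta>" .
    have D: "diameter (f ` K) \<le> 2 * c * (v - u)"
      using diam K unfolding diameter_def by (auto intro!: cSUP_least)
    have "interior K \<subseteq> U"
      using t d(2)[OF t(1)] interior_subset by blast
    moreover have "ennreal (diameter (f ` K)) \<le> ennreal (2 * c) * emeasure lborel (interior K)"
      using D K \<open>0 \<le> c\<close> by (simp add: ennreal_mult[symmetric] ennreal_leI)
    ultimately show ?thesis
      using bdd D small by auto
  qed
  have "f ` S \<subseteq> (\<Union>K\<in>\<D>. f ` K)"
    using \<D>(5) by blast
  then have "hausdorff_premeasure 1 \<delta> (f ` S)
      \<le> (\<integral>\<^sup>+K. (if f ` K = {} then 0 else ennreal (diameter (f ` K) ^ 1)) \<partial>count_space \<D>)"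
    using \<D>(1) K \<open>0 < \<delta>\<close> by (intro hausdorff_premeasure_le_cover) auto
  also have "\<dots> \<le> (\<integral>\<^sup>+K. ennreal (2 * c) * emeasure lborel (interior K) \<partial>count_space \<D>)"
    using K by (intro nn_integral_mono) auto
  also have "\<dots> = ennreal (2 * c) * (\<integral>\<^sup>+K. emeasure lborel (interior K) \<partial>count_space \<D>)"
    by (simp add: nn_integral_cmult)
  also have "(\<integral>\<^sup>+K. emeasure lborel (interior K) \<partial>count_space \<D>) = emeasure lborel (\<Union>K\<in>\<D>. interior K)"
    using \<D>(1,3) by (intro emeasure_UN_countable[symmetric]) (auto simp: disjoint_family_on_def pairwise_def)
  also have "\<dots> \<le> emeasure lborel U"
    using K U by (intro emeasure_mono) auto
  finally show ?thesis
    by (simp add: mult_left_mono)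
qed

text \<open>A Sard theorem for curves: the local Lipschitz constant is as small as desired, while
  \<open>U\<close> stays a fixed bounded interval.\<close>

lemma hausdorff_measure_1_image_zero_derivative:
  fixes f :: "real \<Rightarrow> 'a::real_normed_vector"
  assumes S: "S \<subseteq> {a..b}" and f: "\<And>t. t \<in> S \<Longrightarrow> (f has_vector_derivative 0) (at t)"
  shows "hausdorff_measure 1 (f ` S) = 0"
proof (rule hausdorff_measure_eq_0I)
  show "hausdorff_premeasure 1 \<delta> (f ` S) \<le> ennreal e" if \<delta>: "0 < \<delta>" and e: "0 < e" for \<delta> e
  proof -
    \<comment> \<open>An upper bound for the length of the interval
      \<open>{a - 1<..<max a b + 1}\<close> that serves as \<open>U\<close>.\<close>
    define m where "m = \<bar>b - a\<bar> + 2"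
    have "0 < m"
      by (simp add: m_def)
    then have em: "0 < e / (2 * m)"
      using e by simp
    have "\<exists>h>0. \<forall>s. \<bar>s - t\<bar> < h \<longrightarrow> dist (f s) (f t) \<le> e / (2 * m) * \<bar>s - t\<bar>" if "t \<in> S" for t
    proof -
      have "\<forall>\<epsilon>>0. \<exists>h>0. \<forall>s. \<bar>s - t\<bar> < h \<longrightarrow> dist (f s) (f t) \<le> \<epsilon> * \<bar>s - t\<bar>"
        using f[OF that] by (simp add: has_vector_derivative_def has_derivative_at_alt dist_norm)
      then show ?thesis
        using em by blast
    qed
    then have "hausdorff_premeasure 1 \<delta> (f ` S) \<le> ennreal (2 * (e / (2 * m))) * emeasure lborel {a - 1<..<max a b + 1}"
      using S \<delta> e by (intro hausdorff_premeasure_image_le) (auto simp: m_def)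
    also have "\<dots> = ennreal (e / m * (max a b + 1 - (a - 1)))"
    proof -
      have "emeasure lborel {a - 1<..<max a b + 1} = ennreal (max a b + 1 - (a - 1))"
        by (rule emeasure_lborel_Ioo) simp
      moreover have "2 * (e / (2 * m)) = e / m"
        by simp
      moreover have "ennreal (e / m) * ennreal (max a b + 1 - (a - 1)) = ennreal (e / m * (max a b + 1 - (a - 1)))"
        using e \<open>0 < m\<close> by (intro ennreal_mult[symmetric]) auto
      ultimately show ?thesis by simp
    qed
    also have "\<dots> \<le> ennreal e"
    proof (rule ennreal_leI)
      have "e / m * (max a b + 1 - (a - 1)) \<le> e / m * m"
        using e \<open>0 < m\<close> by (intro mult_left_mono) (auto simp: m_def)
      then show "e / m * (max a b + 1 - (a - 1)) \<le> e"
        using \<open>0 < m\<close> by simp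
    qed
    finally show ?thesis by simp
  qed
qed

text \<open>The complementary case: the constant \<open>L\<close> is fixed, and \<open>U\<close> is
  an open cover of \<open>S\<close> of arbitrarily small measure.\<close>

lemma hausdorff_measure_1_image_negligible:
  fixes f :: "real \<Rightarrow> 'a::metric_space"
  assumes L: "L-lipschitz_on UNIV f" and S: "S \<subseteq> {a..b}" "negligible S"
  shows "hausdorff_measure 1 (f ` S) = 0"
proof (rule hausdorff_measure_eq_0I)
  have L0: "0 \<le> L"
    using L by (rule lipschitz_on_nonneg)
  show "hausdorff_premeasure 1 \<delta> (f ` S) \<le> ennreal e" if \<delta>: "0 < \<delta>" and e: "0 < e" for \<delta> e
  proof -
    have null: "S \<in> sets lebesgue" "emeasure lebesgue S = 0"
      using S by (auto simp: negligible_iff_null_sets)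
    have e': "0 < e / (2 * L + 1)"
      using L0 e by simp
    obtain U where U: "open U" "S \<subseteq> U" "U - S \<in> lmeasurable" "emeasure lebesgue (U - S) < ennreal (e / (2 * L + 1))"
      using sets_lebesgue_outer_open[OF null(1) e'] by metis
    have "emeasure lborel U = emeasure lebesgue U"
      using U(1) by simp
    also have "\<dots> = emeasure lebesgue (U - S)"
      using null U(1) by (intro emeasure_Diff_null_set[symmetric]) auto
    finally have Ue: "emeasure lborel U \<le> ennreal (e / (2 * L + 1))"
      using U by simp
    have "hausdorff_premeasure 1 \<delta> (f ` S) \<le> ennreal (2 * L) * emeasure lborel U"
      using S(1) U(1,2) L0 \<delta>
    proof (rule hausdorff_premeasure_image_le)
      show "\<exists>h>0. \<forall>s. \<bar>s - t\<bar> < h \<longrightarrow> dist (f s) (f t) \<le> L * \<bar>s - t\<bar>" for t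
        using lipschitz_onD[OF L] by (intro exI[of _ 1]) (auto simp: dist_real_def)
    qed
    also have "\<dots> \<le> ennreal (2 * L) * ennreal (e / (2 * L + 1))"
      using Ue by (intro mult_left_mono) auto
    also have "\<dots> = ennreal (2 * L * (e / (2 * L + 1)))"
      using L0 e by (subst ennreal_mult[symmetric]) auto
    also have "\<dots> \<le> ennreal e"
      using L0 e by (intro ennreal_leI) (auto simp: field_simps)
    finally show ?thesis by simp
  qed
qed

section \<open>Hitting probabilities in product measures\<close>

lemma indep_vars_PiM_coordinates:
  fixes B :: "'b pmf" and I :: "'i set"
  shows "prob_space.indep_vars (\<Pi>\<^sub>M i\<in>I. measure_pmf B) (\<lambda>_. measure_pmf B) (\<lambda>i \<omega>. \<omega> i) I"
\<comment> \<open>The criterion by joint distributions, used in the other case, is stated for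
  nonempty index sets.\<close>
proof (cases "I = {}")
  case True
  interpret prob_space "\<Pi>\<^sub>M i\<in>I. measure_pmf B"
    by (intro prob_space_PiM measure_pmf.prob_space_axioms)
  show ?thesis
    unfolding indep_vars_def indep_sets_def using True by auto
next
  case False
  interpret product_prob_space "\<lambda>_. measure_pmf B" I ..
  let ?M = "\<Pi>\<^sub>M i\<in>I. measure_pmf B"
  have "distr ?M ?M (\<lambda>x. \<lambda>i\<in>I. x i) = distr ?M ?M (\<lambda>x. x)"
    by (intro distr_cong) (auto simp: space_PiM)
  also have "\<dots> = ?M"
    by simp
  also have "\<dots> = (\<Pi>\<^sub>M i\<in>I. distr ?M (measure_pmf B) (\<lambda>x. x i))"
    by (intro PiM_cong) (auto simp: PiM_component)
  finally show ?thesis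
    using False by (subst P.indep_vars_iff_distr_eq_PiM') auto
qed

lemma measure_PiM_coordinate_False:
  fixes p :: real
  assumes "i \<in> I" "0 \<le> p" "p \<le> 1"
  shows "measure (\<Pi>\<^sub>M i\<in>I. measure_pmf (bernoulli_pmf p))
    ((\<lambda>\<omega>. \<omega> i) -` {False} \<inter> space (\<Pi>\<^sub>M i\<in>I. measure_pmf (bernoulli_pmf p))) = 1 - p"
proof -
  let ?B = "measure_pmf (bernoulli_pmf p)"
  interpret product_prob_space "\<lambda>_. ?B" I ..
  have "measure (\<Pi>\<^sub>M i\<in>I. ?B) ((\<lambda>\<omega>. \<omega> i) -` {False} \<inter> space (\<Pi>\<^sub>M i\<in>I. ?B))
      = measure (distr (\<Pi>\<^sub>M i\<in>I. ?B) ?B (\<lambda>\<omega>. \<omega> i)) {False}"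
    using assms(1) by (subst measure_distr) (auto intro: measurable_component_singleton)
  also have "\<dots> = measure ?B {False}"
    using PiM_component[OF assms(1)] by simp
  also have "\<dots> = 1 - p"
    using assms by (simp add: measure_pmf_single)
  finally show ?thesis .
qed

text \<open>Disjoint blocks read disjoint sets of labels, so being hit is independent from block to
  block and probabilities multiply. A block of at most \<open>s\<close> labels is missed with
  probability at least \<open>(1 - p) ^ s\<close>.\<close>

lemma prob_all_hit_le:
  fixes I :: "'i set" and p :: real and G :: "'a \<Rightarrow> 'i set"
  defines "M \<equiv> \<Pi>\<^sub>M i\<in>I. measure_pmf (bernoulli_pmf p)"
  assumes p: "0 \<le> p" "p \<le> 1" and A: "finite A"
    and G: "\<And>a. a \<in> A \<Longrightarrow> finite (G a) \<and> G a \<subseteq> I \<and> card (G a) \<le> s"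
    and disj: "disjoint_family_on G A"
  shows "measure M {\<omega> \<in> space M. \<forall>a\<in>A. \<exists>i\<in>G a. \<omega> i} \<le> (1 - (1 - p) ^ s) ^ card A"
proof (cases "A = {}")
  case True
  interpret prob_space M
    unfolding M_def by (intro prob_space_PiM measure_pmf.prob_space_axioms)
  show ?thesis
    using True prob_space by simp
next
  case False
  interpret prob_space M
    unfolding M_def by (intro prob_space_PiM measure_pmf.prob_space_axioms)
  let ?B = "measure_pmf (bernoulli_pmf p)"
  let ?X = "\<lambda>a \<omega>. \<lambda>i\<in>G a. \<omega> i"
  let ?S = "\<lambda>a. {f \<in> space (\<Pi>\<^sub>M i\<in>G a. ?B). \<exists>i\<in>G a. f i}"
  have ind: "indep_vars (\<lambda>_. ?B) (\<lambda>i \<omega>. \<omega> i) I"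
    unfolding M_def by (rule indep_vars_PiM_coordinates)
  have ind': "indep_vars (\<lambda>a. \<Pi>\<^sub>M i\<in>G a. ?B) ?X A"
    using G by (intro indep_vars_restrict[OF ind] disj) auto
  have S: "?S a \<in> sets (\<Pi>\<^sub>M i\<in>G a. ?B)" if "a \<in> A" for a
  proof -
    have "finite (G a)" using G that by blast
    then show ?thesis
      by measurable
  qed
  have vim: "?X a -` ?S a \<inter> space M = {\<omega> \<in> space M. \<exists>i\<in>G a. \<omega> i}" if "a \<in> A" for a
  proof -
    have "?X a \<omega> \<in> space (\<Pi>\<^sub>M i\<in>G a. ?B)" for \<omega>
      by (simp add: space_PiM)
    then show ?thesis
      by auto
  qed
  have one: "prob (?X a -` ?S a \<inter> space M) \<le> 1 - (1 - p) ^ s" if a: "a \<in> A" for a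
  \<comment> \<open>An empty block is never hit. It is split off because an intersection over no
    indices would be \<open>UNIV\<close> instead of the sample space.\<close>
  proof (cases "G a = {}")
    case True
    then show ?thesis
      using p by (simp add: vim[OF a] power_le_one)
  next
    case ne: False
    have Ga: "finite (G a)" "G a \<subseteq> I" "card (G a) \<le> s"
      using G[OF a] by auto
    have sets: "(\<Inter>i\<in>G a. (\<lambda>\<omega>. \<omega> i) -` {False} \<inter> space M) \<in> events"
    proof (rule sets.finite_INT)
      fix i assume "i \<in> G a"
      then have "(\<lambda>\<omega>. \<omega> i) \<in> measurable M ?B"
        using Ga unfolding M_def by (intro measurable_component_singleton) auto
      then show "(\<lambda>\<omega>. \<omega> i) -` {False} \<inter> space M \<in> events"
        by (rule measurable_sets) simp
    qed (use Ga ne in auto)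
    have "?X a -` ?S a \<inter> space M = space M - (\<Inter>i\<in>G a. (\<lambda>\<omega>. \<omega> i) -` {False} \<inter> space M)"
      unfolding vim[OF a] using ne by auto
    then have "prob (?X a -` ?S a \<inter> space M) = 1 - prob (\<Inter>i\<in>G a. (\<lambda>\<omega>. \<omega> i) -` {False} \<inter> space M)"
      using prob_compl[OF sets] by simp
    also have "prob (\<Inter>i\<in>G a. (\<lambda>\<omega>. \<omega> i) -` {False} \<inter> space M)
        = (\<Prod>i\<in>G a. prob ((\<lambda>\<omega>. \<omega> i) -` {False} \<inter> space M))"
      using Ga ne by (intro indep_varsD[OF ind]) auto
    also have "\<dots> = (\<Prod>i\<in>G a. 1 - p)"
      using Ga p unfolding M_def by (intro prod.cong refl measure_PiM_coordinate_False) auto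
    also have "(\<Prod>i\<in>G a. 1 - p) = (1 - p) ^ card (G a)"
      by simp
    also have "1 - (1 - p) ^ card (G a) \<le> 1 - (1 - p) ^ s"
      using Ga p by (simp add: power_decreasing)
    finally show ?thesis .
  qed
  have "{\<omega> \<in> space M. \<forall>a\<in>A. \<exists>i\<in>G a. \<omega> i} = (\<Inter>a\<in>A. {\<omega> \<in> space M. \<exists>i\<in>G a. \<omega> i})"
    using False by auto
  also have "\<dots> = (\<Inter>a\<in>A. ?X a -` ?S a \<inter> space M)"
    by (intro INF_cong refl vim[symmetric])
  finally have "prob {\<omega> \<in> space M. \<forall>a\<in>A. \<exists>i\<in>G a. \<omega> i} = (\<Prod>a\<in>A. prob (?X a -` ?S a \<inter> space M))"
    using indep_varsD_finite[OF ind' False A S] by simp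
  also have "\<dots> \<le> (\<Prod>a\<in>A. 1 - (1 - p) ^ s)"
    using one by (intro prod_mono) auto
  finally show ?thesis
    by simp
qed

lemma sets_all_hit:
  fixes I :: "'i set" and B :: "bool pmf" and G :: "'a \<Rightarrow> 'i set"
  defines "M \<equiv> \<Pi>\<^sub>M i\<in>I. measure_pmf B"
  assumes A: "finite A" and G: "\<And>a. a \<in> A \<Longrightarrow> finite (G a) \<and> G a \<subseteq> I"
  shows "{\<omega> \<in> space M. \<forall>a\<in>A. \<exists>i\<in>G a. \<omega> i} \<in> sets M"
proof (rule sets.sets_Collect_finite_All[OF _ A])
  fix a assume a: "a \<in> A"
  have "{\<omega> \<in> space M. \<omega> i} \<in> sets M" if "i \<in> G a" for i
  proof -
    have "(\<lambda>\<omega>. \<omega> i) \<in> measurable M (measure_pmf B)"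
      using G[OF a] that unfolding M_def by (intro measurable_component_singleton) auto
    then have "(\<lambda>\<omega>. \<omega> i) -` {True} \<inter> space M \<in> sets M"
      by (rule measurable_sets) simp
    also have "(\<lambda>\<omega>. \<omega> i) -` {True} \<inter> space M = {\<omega> \<in> space M. \<omega> i}"
      by auto
    finally show ?thesis .
  qed
  then show "{\<omega> \<in> space M. \<exists>i\<in>G a. \<omega> i} \<in> sets M"
    using G[OF a] by (intro sets.sets_Collect_finite_Ex) auto
qed

section \<open>Aligned cells\<close>

definition int_box :: "int \<Rightarrow> ('d::finite \<Rightarrow> int) set" where
  "int_box r = {v. \<forall>i. \<bar>v i\<bar> \<le> r}"

lemma int_box_eq_PiE: "int_box r = (\<Pi>\<^sub>E i\<in>UNIV. {- r..r})"
  by (auto simp: int_box_def PiE_UNIV_domain abs_le_iff Pi_iff) (metis minus_le_iff)+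

lemma finite_int_box [simp]: "finite (int_box r)"
  by (simp add: int_box_eq_PiE finite_PiE)

lemma card_int_box: "card (int_box (int r) :: ('d::finite \<Rightarrow> int) set) = (2 * r + 1) ^ CARD('d)"
  by (simp add: int_box_eq_PiE card_PiE nat_add_distrib nat_mult_distrib)

definition grid_cube :: "nat \<Rightarrow> nat \<Rightarrow> ('d::finite \<Rightarrow> nat) \<Rightarrow> (real ^ 'd) set" where
  "grid_cube N n l = cbox (\<chi> i. (real (l i) - 1) / real N ^ n) (\<chi> i. real (l i) / real N ^ n)"

lemma grid_cubes_eq: "grid_cubes N n = {grid_cube N n l | l. \<forall>i. l i \<in> {1..N ^ n}}"
  by (simp add: grid_cubes_def grid_cube_def)

lemma mem_grid_cube:
  assumes "N > 0"
  shows "x \<in> grid_cube N n l \<longleftrightarrow> (\<forall>i. real (l i) - 1 \<le> x $ i * real N ^ n \<and> x $ i * real N ^ n \<le> real (l i))"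
  using assms by (auto simp: grid_cube_def mem_box_cart field_simps)

text \<open>The difference of opposite corners gives the side length and thus the level, as
  \<open>N \<ge> 2\<close>; the corner then gives the index. Distinct indices or levels therefore
  carry distinct labels.\<close>

lemma grid_cube_inject:
  fixes l k :: "'d::finite \<Rightarrow> nat"
  assumes N: "N \<ge> 2" and eq: "grid_cube N n l = grid_cube N m k"
  shows "n = m \<and> l = k"
proof -
  have pos: "real N ^ j > 0" for j
    using N by simp
  have "cbox (\<chi> i. (real (l i) - 1) / real N ^ n) (\<chi> i. real (l i) / real N ^ n) \<noteq> {}"
    using pos by (simp add: interval_ne_empty_cart divide_right_mono)
  with eq have ends: "(\<chi> i. (real (l i) - 1) / real N ^ n) = (\<chi> i. (real (k i) - 1) / real N ^ m)"
      "(\<chi> i. real (l i) / real N ^ n) = (\<chi> i. real (k i) / real N ^ m)"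
    unfolding grid_cube_def eq_cbox by auto
  have lo: "(real (l i) - 1) / real N ^ n = (real (k i) - 1) / real N ^ m"
    and hi: "real (l i) / real N ^ n = real (k i) / real N ^ m" for i
    using ends by (auto simp: vec_eq_iff)
  \<comment> \<open>Any coordinate shows the side length; \<open>undefined\<close> merely names
    one.\<close>
  have "1 / real N ^ n = 1 / real N ^ m"
    using lo[of undefined] hi[of undefined] by (simp add: diff_divide_distrib)
  then have "real N ^ n = real N ^ m"
    by simp
  then have nm: "n = m"
    using N by simp
  have "l i = k i" for i
    using hi[of i] N unfolding nm by simp
  with nm show ?thesis by auto
qed

text \<open>
  The distance \<open>5\<close> absorbs all rounding errors below, and centres \<open>11 > 2 * 5\<close> apart have disjoint
  sets of near cubes; hence the spacing \<open>11\<close> in the directions.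
\<close>

definition near_cubes :: "nat \<Rightarrow> nat \<Rightarrow> ('d::finite \<Rightarrow> int) \<Rightarrow> (real ^ 'd) set set" where
  "near_cubes N n c = {grid_cube N n l | l. (\<forall>i. l i \<in> {1..N ^ n}) \<and> (\<forall>i. \<bar>int (l i) - c i\<bar> \<le> 5)}"

lemma near_cubes_subset: "near_cubes N n c \<subseteq> grid_cubes N n"
  by (auto simp: near_cubes_def grid_cubes_eq)

lemma near_cubes_subset_image:
  "near_cubes N n c \<subseteq> (\<lambda>e. grid_cube N n (\<lambda>i. nat (c i + e i))) ` int_box 5"
proof
  fix Q assume "Q \<in> near_cubes N n c"
  then obtain l where "Q = grid_cube N n l" "\<forall>i. \<bar>int (l i) - c i\<bar> \<le> 5"
    by (auto simp: near_cubes_def)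
  then show "Q \<in> (\<lambda>e. grid_cube N n (\<lambda>i. nat (c i + e i))) ` int_box 5"
    by (intro image_eqI[of _ _ "\<lambda>i. int (l i) - c i"]) (auto simp: int_box_def)
qed

lemma finite_near_cubes: "finite (near_cubes N n c)"
  using finite_subset[OF near_cubes_subset_image] by simp

lemma card_near_cubes_le: "card (near_cubes N n (c :: 'd::finite \<Rightarrow> int)) \<le> 11 ^ CARD('d)"
proof -
  have "card (near_cubes N n c) \<le> card (int_box 5 :: ('d \<Rightarrow> int) set)"
    by (rule surj_card_le[OF finite_int_box near_cubes_subset_image])
  then show ?thesis
    using card_int_box[where r = 5 and 'd = 'd] by simp
qed

text \<open>The step \<open>v / W\<close> is rational with denominator \<open>W\<close>: finitely
  many integer vectors \<open>v\<close> then represent all directions, with a rounding error that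
  stays bounded over all \<open>W\<close> positions.\<close>

definition lattice_line :: "nat \<Rightarrow> ('d \<Rightarrow> int) \<Rightarrow> ('d \<Rightarrow> int) \<Rightarrow> nat \<Rightarrow> 'd \<Rightarrow> int" where
  "lattice_line W k v w = (\<lambda>i. k i + (int w * v i) div int W)"

text \<open>A coordinate of modulus exactly \<open>11 * int W\<close> makes the division by
  \<open>W\<close> exact there, so rounding cannot bring two positions of a line closer than
  \<open>11\<close>.\<close>

definition directions :: "nat \<Rightarrow> ('d::finite \<Rightarrow> int) set" where
  "directions W = {v \<in> int_box (11 * int W). \<exists>i. \<bar>v i\<bar> = 11 * int W}"

text \<open>At different levels the cubes have different sizes. At the same level both positions lie
  on one line, and a shared cube would put them within \<open>10\<close> of each other in the
  coordinate where they are at least \<open>11\<close> apart. This supplies the disjoint blocks for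
  \<open>prob_all_hit_le\<close>.\<close>

lemma near_cubes_disjoint:
  assumes N: "N \<ge> 2" and W: "w < W" "w' < W" and v: "n = n' \<Longrightarrow> v = v' \<and> k = k'" "v \<in> directions W"
    and ne: "(n, w) \<noteq> (n', w')"
  shows "near_cubes N n (lattice_line W k v w) \<inter> near_cubes N n' (lattice_line W k' v' w') = {}"
proof (rule ccontr)
  assume "\<not> ?thesis"
  then obtain l l' where l: "grid_cube N n l = grid_cube N n' l'"
      "\<forall>i. \<bar>int (l i) - lattice_line W k v w i\<bar> \<le> 5" "\<forall>i. \<bar>int (l' i) - lattice_line W k' v' w' i\<bar> \<le> 5"
    by (auto simp: near_cubes_def)
  from grid_cube_inject[OF N l(1)] have eq: "n = n'" "l = l'"
    by auto
  with v have v': "v' = v" "k' = k" by auto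
  obtain i where i: "\<bar>v i\<bar> = 11 * int W"
    using v(2) by (auto simp: directions_def)
  have "\<bar>(int w * v i) div int W - (int w' * v i) div int W\<bar> \<le> 10"
    using l(2,3)[THEN spec, of i] unfolding eq v' lattice_line_def by linarith
  moreover have "v i = int W * 11 \<or> v i = int W * (- 11)"
    using i by linarith
  then obtain c where c: "v i = int W * c" "c = 11 \<or> c = - 11"
    by blast
  moreover have "(int u * v i) div int W = int u * c" for u
    unfolding c(1) using W by (metis mult.left_commute nonzero_mult_div_cancel_left of_nat_eq_0_iff not_less_zero)
  ultimately have "\<bar>int w * c - int w' * c\<bar> \<le> 10"
    by simp
  with c(2) have "int w = int w'" by (elim disjE; hypsubst; linarith)
  then have "w = w'" by simp
  with eq ne show False by simp
qed

text \<open>Only labels of level \<open>n\<close> enter, not whether the cubes meet the percolation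
  set; this makes different levels independent.\<close>

definition aligned :: "nat \<Rightarrow> nat \<Rightarrow> nat \<Rightarrow> ('d::finite \<Rightarrow> int) \<Rightarrow> ((real ^ 'd) set \<Rightarrow> bool) \<Rightarrow> bool" where
  "aligned N W n k \<omega> \<longleftrightarrow>
     (\<exists>v\<in>directions W. \<forall>w<W. \<exists>Q\<in>near_cubes N n (lattice_line W k v w). \<omega> Q)"

section \<open>Probability of alignment at many levels\<close>

abbreviation label_measure :: "nat \<Rightarrow> real \<Rightarrow> ((real ^ 'd::finite) set \<Rightarrow> bool) measure" where
  "label_measure N p \<equiv> (\<Pi>\<^sub>M Q \<in> (\<Union>n. grid_cubes N n). measure_pmf (bernoulli_pmf p))"

text \<open>A union bound over the choices \<open>V\<close> of one direction per level. For fixed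
  \<open>V\<close> the \<open>card L * W\<close> blocks are disjoint, and each is hit with
  probability at most \<open>1 - (1 - p) ^ 11 ^ CARD('d)\<close>. The base
  \<open>22 * real W + 1\<close> counts the integers of modulus at most
  \<open>11 * W\<close>.\<close>

lemma prob_aligned:
  fixes \<kappa> :: "nat \<Rightarrow> 'd::finite \<Rightarrow> int" and p :: real and W :: nat
  assumes N: "N \<ge> 2" and p: "0 \<le> p" "p \<le> 1" and L: "finite L"
  defines "M \<equiv> label_measure N p"
  defines "E \<equiv> {\<omega> \<in> space M. \<forall>n\<in>L. aligned N W n (\<kappa> n) \<omega>}"
  shows "E \<in> sets M"
    "measure M E \<le> ((22 * real W + 1) ^ CARD('d) * (1 - (1 - p) ^ 11 ^ CARD('d)) ^ W) ^ card L"
proof -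
  interpret prob_space M
    unfolding M_def by (intro prob_space_PiM measure_pmf.prob_space_axioms)
  let ?D = "directions W :: ('d \<Rightarrow> int) set"
  let ?V = "\<Pi>\<^sub>E n\<in>L. ?D"
  let ?A = "L \<times> {..<W}"
  let ?G = "\<lambda>V (n, w). near_cubes N n (lattice_line W (\<kappa> n) (V n) w)"
  let ?q = "1 - (1 - p) ^ 11 ^ CARD('d)"
  define F where "F V = {\<omega> \<in> space M. \<forall>a\<in>?A. \<exists>Q\<in>?G V a. \<omega> Q}" for V
  have q: "0 \<le> ?q"
    using p by (simp add: power_le_one)
  have finD: "finite ?D"
    by (rule finite_subset[OF _ finite_int_box]) (auto simp: directions_def)
  have "card ?D \<le> card (int_box (int (11 * W)) :: ('d \<Rightarrow> int) set)"
    by (intro card_mono finite_int_box) (auto simp: directions_def)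
  then have cardD: "real (card ?D) \<le> (22 * real W + 1) ^ CARD('d)"
    unfolding card_int_box by (drule_tac of_nat_mono[where 'a = real]) (simp add: algebra_simps)
  have finV: "finite ?V"
    using L finD by (intro finite_PiE)
  have G: "finite (?G V a) \<and> ?G V a \<subseteq> (\<Union>n. grid_cubes N n) \<and> card (?G V a) \<le> 11 ^ CARD('d)" for V a
    using near_cubes_subset finite_near_cubes card_near_cubes_le by (cases a) fastforce
  have EF: "E = (\<Union>V\<in>?V. F V)"
  proof (intro equalityI subsetI)
    fix \<omega> assume \<omega>: "\<omega> \<in> E"
    then have "\<forall>n\<in>L. \<exists>v. v \<in> ?D \<and> (\<forall>w<W. \<exists>Q\<in>near_cubes N n (lattice_line W (\<kappa> n) v w). \<omega> Q)"
      by (auto simp: E_def aligned_def)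
    from bchoice[OF this] obtain V where
      "\<forall>n\<in>L. V n \<in> ?D \<and> (\<forall>w<W. \<exists>Q\<in>near_cubes N n (lattice_line W (\<kappa> n) (V n) w). \<omega> Q)" ..
    then have "restrict V L \<in> ?V \<and> \<omega> \<in> F (restrict V L)"
      using \<omega> by (auto simp: E_def F_def)
    then show "\<omega> \<in> (\<Union>V\<in>?V. F V)" by blast
  next
    fix \<omega> assume "\<omega> \<in> (\<Union>V\<in>?V. F V)"
    then obtain V where V: "V \<in> ?V" "\<omega> \<in> F V" by blast
    have "aligned N W n (\<kappa> n) \<omega>" if "n \<in> L" for n
      unfolding aligned_def
    proof (rule bexI[of _ "V n"])
      show "V n \<in> ?D"
        using V(1) that by (rule PiE_mem)
      show "\<forall>w<W. \<exists>Q\<in>near_cubes N n (lattice_line W (\<kappa> n) (V n) w). \<omega> Q"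
        using V(2) that by (auto simp: F_def)
    qed
    then show "\<omega> \<in> E"
      using V(2) by (simp add: E_def F_def)
  qed
  have Fsets: "F V \<in> events" for V
    unfolding F_def M_def using L G by (intro sets_all_hit) auto
  show "E \<in> events"
    unfolding EF using finV Fsets by (intro sets.finite_UN)
  have Fprob: "prob (F V) \<le> ?q ^ (card L * W)" if "V \<in> ?V" for V
  proof -
    have "disjoint_family_on (?G V) ?A"
      unfolding disjoint_family_on_def
    proof (intro ballI impI)
      fix a a' assume "a \<in> ?A" "a' \<in> ?A" "a \<noteq> a'"
      moreover obtain n w n' w' where "a = (n, w)" "a' = (n', w')"
        by (cases a, cases a')
      ultimately show "?G V a \<inter> ?G V a' = {}"
        using that near_cubes_disjoint[OF N, of w W w' n n' "V n" "V n'" "\<kappa> n" "\<kappa> n'"]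
        by (auto simp: PiE_mem)
    qed
    then have "prob (F V) \<le> ?q ^ card ?A"
      unfolding F_def M_def using L p G by (intro prob_all_hit_le) auto
    then show ?thesis by (simp only: card_cartesian_product card_lessThan)
  qed
  have "prob E \<le> (\<Sum>V\<in>?V. prob (F V))"
    unfolding EF using finV Fsets by (intro measure_UNION_le) auto
  also have "\<dots> \<le> (\<Sum>V\<in>?V. ?q ^ (card L * W))"
    by (intro sum_mono Fprob)
  also have "\<dots> = real (card ?D) ^ card L * ?q ^ (card L * W)"
    using L by (simp add: card_PiE)
  also have "\<dots> = (real (card ?D) * ?q ^ W) ^ card L"
    by (simp add: power_mult_distrib power_mult mult.commute[of "card L"])
  also have "\<dots> \<le> ((22 * real W + 1) ^ CARD('d) * ?q ^ W) ^ card L"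
    using cardD q by (intro power_mono mult_right_mono) auto
  finally show "prob E \<le> ((22 * real W + 1) ^ CARD('d) * ?q ^ W) ^ card L" .
qed

lemma small_alignment_probability:
  fixes q :: real and a d :: nat
  assumes "0 \<le> q" "q < 1" "0 < d"
  shows "\<exists>W>0. real a * ((22 * real W + 1) ^ d * q ^ W) \<le> 1 / 2"
proof -
  \<comment> \<open>Taking the root moves the polynomial and the exponential under one power
    \<open>d\<close>, leaving only \<open>W * r ^ W\<close> tending to \<open>0\<close>.\<close>
  define r where "r = root d q"
  have r: "0 \<le> r" "r < 1" "r ^ d = q"
    using assms by (auto simp: r_def)
  have "(\<lambda>W. real a * (22 * (real W * r ^ W) + r ^ W) ^ d) \<longlonglongrightarrow> real a * (22 * 0 + 0) ^ d"
    using r by (intro tendsto_intros powser_times_n_limit_0 LIMSEQ_power_zero) auto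
  then have "(\<lambda>W. real a * (22 * (real W * r ^ W) + r ^ W) ^ d) \<longlonglongrightarrow> 0"
    using assms(3) by (simp add: zero_power)
  then have "eventually (\<lambda>W. real a * (22 * (real W * r ^ W) + r ^ W) ^ d < 1 / 2) sequentially"
    by (rule order_tendstoD) simp
  then have "eventually (\<lambda>W. W > 0 \<and> real a * (22 * (real W * r ^ W) + r ^ W) ^ d < 1 / 2) sequentially"
    using eventually_gt_at_top[of 0] by eventually_elim auto
  then obtain W where W: "W > 0" "real a * (22 * (real W * r ^ W) + r ^ W) ^ d < 1 / 2"
    using eventually_happens'[OF sequentially_bot] by blast
  have "22 * (real W * r ^ W) + r ^ W = (22 * real W + 1) * r ^ W"
    by (simp add: algebra_simps)
  then have "(22 * (real W * r ^ W) + r ^ W) ^ d = (22 * real W + 1) ^ d * q ^ W"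
    using r(3) by (simp add: power_mult_distrib power_mult[symmetric] mult.commute[of W])
      (simp add: power_mult)
  with W show ?thesis by auto
qed

text \<open>Indices start at \<open>0\<close>, whereas those of \<open>grid_cube\<close> start at
  \<open>1\<close>; the shift is absorbed by the distance allowed in \<open>near_cubes\<close>.
  Rounding down picks a single cell also for points on faces.\<close>

definition cell :: "nat \<Rightarrow> nat \<Rightarrow> real ^ 'd \<Rightarrow> 'd \<Rightarrow> int" where
  "cell N n x = (\<lambda>i. \<lfloor>x $ i * real N ^ n\<rfloor>)"

text \<open>The finest cell determines all coarser ones, so a chain of nested cells is counted by
  its last member.\<close>

lemma cell_div:
  assumes "n \<le> m" "N > 0"
  shows "cell N n x i = cell N m x i div int N ^ (m - n)"
proof -
  have "real N ^ m = real N ^ n * real N ^ (m - n)"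
    using assms(1) by (simp flip: power_add)
  then have "x $ i * real N ^ n = (x $ i * real N ^ m) / real_of_int (int N ^ (m - n))"
    using assms(2) by simp
  then show ?thesis
    unfolding cell_def by (simp only: floor_divide_real_eq_div zero_le_power of_nat_0_le_iff)
qed

lemma finite_lattice_cube: "finite {y :: 'd::finite \<Rightarrow> int. \<forall>i. 0 \<le> y i \<and> y i \<le> int a}"
  and card_lattice_cube: "card {y :: 'd::finite \<Rightarrow> int. \<forall>i. 0 \<le> y i \<and> y i \<le> int a} = (a + 1) ^ CARD('d)"
proof -
  have *: "{y :: 'd \<Rightarrow> int. \<forall>i. 0 \<le> y i \<and> y i \<le> int a} = (\<Pi>\<^sub>E i\<in>UNIV. {0..int a})"
    by (auto simp: PiE_UNIV_domain Pi_iff)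
  show "finite {y :: 'd \<Rightarrow> int. \<forall>i. 0 \<le> y i \<and> y i \<le> int a}"
    unfolding * by (simp add: finite_PiE)
  show "card {y :: 'd \<Rightarrow> int. \<forall>i. 0 \<le> y i \<and> y i \<le> int a} = (a + 1) ^ CARD('d)"
    unfolding * by (simp add: card_PiE nat_add_distrib)
qed

text \<open>
  A union bound over the chains of nested cells: each further level multiplies the number of chains
  by \<open>N ^ d\<close>, and the probability that a given chain is aligned by at most \<open>N ^ (- d) / 2\<close>.
\<close>

lemma AE_not_always_aligned:
  fixes N :: nat and p :: real
  assumes N: "N \<ge> 2" and p: "0 \<le> p" "p < 1"
  shows "\<exists>W>0. AE \<omega> in (label_measure N p :: ((real ^ 'd::finite) set \<Rightarrow> bool) measure).
    \<forall>n0 x. (\<forall>i. 0 \<le> x $ i \<and> x $ i \<le> 1) \<longrightarrow> (\<exists>n\<ge>n0. \<not> aligned N W n (cell N n x) \<omega>)"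
proof -
  let ?d = "CARD('d)"
  let ?q = "1 - (1 - p) ^ 11 ^ ?d"
  have "0 \<le> ?q" "?q < 1"
    using p by (auto simp: power_le_one)
  then obtain W where W: "W > 0" "real (N ^ ?d) * ((22 * real W + 1) ^ ?d * ?q ^ W) \<le> 1 / 2"
    using small_alignment_probability[of ?q ?d "N ^ ?d"] by auto
  define M where "M = (label_measure N p :: ((real ^ 'd) set \<Rightarrow> bool) measure)"
  interpret prob_space M
    unfolding M_def by (intro prob_space_PiM measure_pmf.prob_space_axioms)
  define b where "b = (22 * real W + 1) ^ ?d * ?q ^ W"
  have b: "0 \<le> b" "real (N ^ ?d) * b \<le> 1 / 2"
    using W(2) \<open>0 \<le> ?q\<close> by (auto simp: b_def)
  have "AE \<omega> in M. \<forall>x. (\<forall>i. 0 \<le> x $ i \<and> x $ i \<le> 1) \<longrightarrow> (\<exists>n\<ge>n0. \<not> aligned N W n (cell N n x) \<omega>)" for n0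
  proof -
    \<comment> \<open>The value \<open>N ^ (n0 + m)\<close> itself is included because a coordinate
      equal to \<open>1\<close> is rounded to it.\<close>
    define Y where "Y m = {y :: 'd \<Rightarrow> int. \<forall>i. 0 \<le> y i \<and> y i \<le> int (N ^ (n0 + m))}" for m
    define E where "E m y = {\<omega> \<in> space M. \<forall>n\<in>{n0..<n0 + m}. aligned N W n (\<lambda>i. y i div int N ^ (n0 + m - n)) \<omega>}" for m y
    \<comment> \<open>Some chain of length \<open>m\<close> starting at level \<open>n0\<close> is
      aligned throughout. Finitely many cells \<open>y\<close> stand in for the uncountably many
      points \<open>x\<close>, and an exceptional \<open>x\<close> puts \<open>\<omega>\<close> into
      every \<open>U m\<close>.\<close>
    define U where "U m = (\<Union>y\<in>Y m. E m y)" for m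
    have E: "E m y \<in> events" "prob (E m y) \<le> b ^ m" for m y
      using prob_aligned[OF N p(1) less_imp_le[OF p(2)], of "{n0..<n0 + m}" W "\<lambda>n i. y i div int N ^ (n0 + m - n)"]
      by (simp_all add: E_def M_def b_def)
    have finY: "finite (Y m)" for m
      unfolding Y_def by (rule finite_lattice_cube)
    have U: "U m \<in> events" for m
      unfolding U_def using finY E by (intro sets.finite_UN)
    have "prob (U m) \<le> (2 * real N ^ n0) ^ ?d * (1 / 2) ^ m" for m
    proof -
      have "prob (U m) \<le> (\<Sum>y\<in>Y m. prob (E m y))"
        unfolding U_def using finY E by (intro measure_UNION_le)
      also have "\<dots> \<le> (\<Sum>y\<in>Y m. b ^ m)"
        by (intro sum_mono E)
      also have "\<dots> = (real N ^ (n0 + m) + 1) ^ ?d * b ^ m"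
        by (simp only: sum_constant Y_def card_lattice_cube) (simp add: add.commute)
      also have "\<dots> \<le> (2 * real N ^ (n0 + m)) ^ ?d * b ^ m"
        using N b by (intro mult_right_mono power_mono) auto
      also have "\<dots> = (2 * real N ^ n0) ^ ?d * (real (N ^ ?d) * b) ^ m"
        by (simp add: power_add power_mult_distrib power_mult[symmetric] mult.commute mult.left_commute)
      also have "\<dots> \<le> (2 * real N ^ n0) ^ ?d * (1 / 2) ^ m"
        using b by (intro mult_left_mono power_mono) auto
      finally show ?thesis .
    qed
    then have bound: "prob (\<Inter>m. U m) \<le> (2 * real N ^ n0) ^ ?d * (1 / 2) ^ m" for m
      using U finite_measure_mono[of "\<Inter>m. U m" "U m"] by (meson INF_lower UNIV_I order_trans)
    have "(\<lambda>m. (2 * real N ^ n0) ^ ?d * (1 / 2) ^ m) \<longlonglongrightarrow> (2 * real N ^ n0) ^ ?d * 0"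
      by (intro tendsto_mult tendsto_const LIMSEQ_power_zero) auto
    then have "prob (\<Inter>m. U m) \<le> (2 * real N ^ n0) ^ ?d * 0"
      using bound by (intro LIMSEQ_le_const) auto
    then have "prob (\<Inter>m. U m) = 0"
      by (intro antisym) simp_all
    then have "emeasure M (\<Inter>m. U m) = 0"
      by (simp only: emeasure_eq_measure ennreal_0)
    then have null: "(\<Inter>m. U m) \<in> null_sets M"
      using U by (auto intro!: null_setsI sets.countable_INT)
    show ?thesis
    proof (rule AE_I'[OF null], rule subsetI, rule INT_I)
      fix \<omega> m
      assume "\<omega> \<in> {\<omega> \<in> space M. \<not> (\<forall>x. (\<forall>i. 0 \<le> x $ i \<and> x $ i \<le> 1) \<longrightarrow>
        (\<exists>n\<ge>n0. \<not> aligned N W n (cell N n x) \<omega>))}"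
      then obtain x :: "real ^ 'd" where \<omega>: "\<omega> \<in> space M" and x: "\<forall>i. 0 \<le> x $ i \<and> x $ i \<le> 1"
        and al: "\<not> (\<exists>n\<ge>n0. \<not> aligned N W n (cell N n x) \<omega>)"
        by blast
      have "cell N (n0 + m) x \<in> Y m"
      proof -
        have "0 \<le> \<lfloor>x $ i * real N ^ (n0 + m)\<rfloor> \<and> \<lfloor>x $ i * real N ^ (n0 + m)\<rfloor> \<le> int (N ^ (n0 + m))" for i
        proof -
          have "x $ i * real N ^ (n0 + m) \<le> 1 * real N ^ (n0 + m)"
            using x by (intro mult_right_mono) auto
          then show ?thesis
            using x by (simp add: floor_le_iff)
        qed
        then show ?thesis
          by (simp add: Y_def cell_def)
      qed
      moreover have "\<omega> \<in> E m (cell N (n0 + m) x)"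
        unfolding E_def
      proof (intro CollectI conjI ballI)
        fix n assume n: "n \<in> {n0..<n0 + m}"
        have "(\<lambda>i. cell N (n0 + m) x i div int N ^ (n0 + m - n)) = cell N n x"
          using n N by (intro ext cell_div[symmetric]) auto
        then show "aligned N W n (\<lambda>i. cell N (n0 + m) x i div int N ^ (n0 + m - n)) \<omega>"
          using al n by auto
      qed (rule \<omega>)
      ultimately show "\<omega> \<in> U m"
        unfolding U_def by blast
    qed
  qed
  then have "AE \<omega> in M. \<forall>n0 x. (\<forall>i. 0 \<le> x $ i \<and> x $ i \<le> 1) \<longrightarrow> (\<exists>n\<ge>n0. \<not> aligned N W n (cell N n x) \<omega>)"
    by (simp add: AE_all_countable)
  with W(1) show ?thesis
    unfolding M_def by blast
qed

section \<open>Curves meeting the percolation set\<close>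

lemma aligned_if_near_segment:
  fixes x u :: "real ^ 'd"
  assumes N: "N \<ge> 2" and W: "W > 0" and u: "\<And>i. \<bar>u $ i\<bar> \<le> 1" "\<bar>u $ i0\<bar> = 1"
    and near: "\<And>w. w < W \<Longrightarrow> \<exists>z\<in>percolation_set N \<omega>. \<forall>i.
      \<bar>z $ i - x $ i - 11 * real w / real N ^ n * u $ i\<bar> \<le> 1 / real N ^ n"
  shows "aligned N W n (cell N n x) \<omega>"
proof -
  \<comment> \<open>Rounding costs less than \<open>1\<close> per coordinate of \<open>v\<close>,
    hence less than \<open>1\<close> after \<open>w < W\<close> steps of size \<open>v / W\<close>.
    At \<open>i0\<close> nothing is lost, since \<open>u $ i0\<close> is \<open>1\<close> or
    \<open>- 1\<close>, so \<open>v\<close> is a direction.\<close>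
  define v where "v i = \<lfloor>11 * real W * u $ i\<rfloor>" for i
  have v_le: "real_of_int (v i) \<le> 11 * real W * u $ i" and v_gt: "11 * real W * u $ i < real_of_int (v i) + 1" for i
    unfolding v_def by linarith+
  have "\<bar>v i\<bar> \<le> 11 * int W" for i
  proof -
    have "\<bar>11 * real W * u $ i\<bar> \<le> 11 * real W * 1"
      using u(1)[of i] unfolding abs_mult by (intro mult_mono) auto
    then have "real_of_int (v i) \<le> 11 * real W" "- (11 * real W) < real_of_int (v i) + 1"
      using v_le[of i] v_gt[of i] by linarith+
    then show ?thesis by linarith
  qed
  moreover have "\<bar>v i0\<bar> = 11 * int W"
  proof -
    have "u $ i0 = 1 \<or> u $ i0 = - 1"
      using u(2) by linarith
    then have "11 * real W * u $ i0 = real_of_int (11 * int W) \<or> 11 * real W * u $ i0 = real_of_int (- 11 * int W)"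
      by auto
    then have "v i0 = 11 * int W \<or> v i0 = - 11 * int W"
      unfolding v_def by (elim disjE; simp only: floor_of_int) simp_all
    then show ?thesis
      by auto
  qed
  ultimately have vD: "v \<in> directions W"
    by (auto simp: directions_def int_box_def)
  have "\<exists>Q\<in>near_cubes N n (lattice_line W (cell N n x) v w). \<omega> Q" if w: "w < W" for w
  proof -
    obtain z where z: "z \<in> percolation_set N \<omega>"
      "\<And>i. \<bar>z $ i - x $ i - 11 * real w / real N ^ n * u $ i\<bar> \<le> 1 / real N ^ n"
      using near[OF w] by blast
    then obtain Q where "Q \<in> chosen_cubes N \<omega> n" "z \<in> Q"
      by (auto simp: percolation_set_def)
    then obtain l where l: "\<omega> (grid_cube N n l)" "\<forall>i. l i \<in> {1..N ^ n}" "z \<in> grid_cube N n l"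
      by (auto simp: chosen_cubes_def grid_cubes_eq)
    have "\<bar>int (l i) - lattice_line W (cell N n x) v w i\<bar> \<le> 5" for i
    proof -
      let ?X = "x $ i * real N ^ n" and ?Z = "z $ i * real N ^ n" and ?s = "11 * real w * u $ i"
      let ?c = "(int w * v i) div int W"
      have Np: "real N ^ n > 0"
        using N by simp
      have "\<bar>z $ i - x $ i - 11 * real w / real N ^ n * u $ i\<bar> * real N ^ n \<le> 1 / real N ^ n * real N ^ n"
        using z(2) Np by (intro mult_right_mono) auto
      also have "1 / real N ^ n * real N ^ n = 1"
        using Np by simp
      also have "\<bar>z $ i - x $ i - 11 * real w / real N ^ n * u $ i\<bar> * real N ^ n
          = \<bar>(z $ i - x $ i - 11 * real w / real N ^ n * u $ i) * real N ^ n\<bar>"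
        using Np by (simp add: abs_mult)
      also have "(z $ i - x $ i - 11 * real w / real N ^ n * u $ i) * real N ^ n = ?Z - ?X - ?s"
        using Np by (simp add: field_simps)
      finally have Z: "\<bar>?Z - ?X - ?s\<bar> \<le> 1" .
      have lZ: "real (l i) - 1 \<le> ?Z" "?Z \<le> real (l i)"
        using l(3) N by (auto simp: mem_grid_cube)
      have c: "?c = \<lfloor>real_of_int (int w * v i) / real W\<rfloor>"
        using floor_divide_of_int_eq[of "int w * v i" "int W", where 'a = real] by simp
      have "real w * real_of_int (v i) \<le> real w * (11 * real W * u $ i)"
        using v_le[of i] by (intro mult_left_mono) auto
      then have c1: "real_of_int (int w * v i) / real W \<le> ?s"
        using W by (simp add: field_simps)
      have "real w * (11 * real W * u $ i) \<le> real w * (real_of_int (v i) + 1)"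
        using v_gt[of i] by (intro mult_left_mono) auto
      also have "\<dots> \<le> real w * real_of_int (v i) + real W"
        using w by (simp add: algebra_simps)
      finally have c2: "?s \<le> real_of_int (int w * v i) / real W + 1"
        using W by (simp add: field_simps)
      have "real_of_int ?c \<le> ?s" "?s < real_of_int ?c + 2"
        unfolding c using c1 c2 by linarith+
      moreover have "real_of_int (cell N n x i) \<le> ?X" "?X < real_of_int (cell N n x i) + 1"
        unfolding cell_def by linarith+
      \<comment> \<open>The errors \<open>l i - ?Z\<close> in [0, 1], \<open>?Z - ?X - ?s\<close> in
        [-1, 1], \<open>?X - cell N n x i\<close> in [0, 1) and \<open>?s - ?c\<close> in [0, 2) add
        up to a number in [-1, 5).\<close>
      ultimately have "\<bar>real_of_int (int (l i) - (cell N n x i + ?c))\<bar> \<le> 5"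
        using Z lZ by simp
      then show ?thesis
        unfolding lattice_line_def by linarith
    qed
    with l(1,2) show ?thesis
      by (auto simp: near_cubes_def)
  qed
  with vD show ?thesis
    by (auto simp: aligned_def)
qed

text \<open>
  The distance to \<open>K\<close> vanishes on \<open>K\<close>, so its derivative at a point of \<open>K\<close> can only be zero: this says
  that \<open>K\<close> leaves no gap near \<open>t\<close> comparable to the distance from \<open>t\<close>, and it replaces the Lebesgue
  density theorem.
\<close>

lemma has_derivative_infdist_zero:
  fixes K :: "real set"
  assumes "(\<lambda>s. infdist s K) differentiable at t" "t \<in> K"
  shows "((\<lambda>s. infdist s K) has_vector_derivative 0) (at t)"
proof -
  obtain D where D: "((\<lambda>s. infdist s K) has_real_derivative D) (at t)"
    using assms(1) real_differentiable_def by blast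
  have "D = 0"
    using DERIV_local_min[OF D, of 1] assms(2) by (auto simp: infdist_nonneg)
  with D show ?thesis
    by (simp add: has_real_derivative_iff_has_vector_derivative)
qed

section \<open>Alignment at points of differentiability of a curve\<close>

lemma has_vector_derivative_increment:
  fixes f :: "real \<Rightarrow> 'a::real_normed_vector"
  assumes "(f has_vector_derivative e) (at t)" "0 < c"
  shows "\<exists>h>0. \<forall>s. \<bar>s\<bar> < h \<longrightarrow> norm (f (t + s) - f t - s *\<^sub>R e) \<le> c * \<bar>s\<bar>"
proof -
  have "\<forall>c>0. \<exists>h>0. \<forall>y. \<bar>y - t\<bar> < h \<longrightarrow> norm (f y - f t - (y - t) *\<^sub>R e) \<le> c * \<bar>y - t\<bar>"
    using assms(1) by (simp add: has_vector_derivative_def has_derivative_at_alt)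
  then obtain h where "h > 0" "\<forall>y. \<bar>y - t\<bar> < h \<longrightarrow> norm (f y - f t - (y - t) *\<^sub>R e) \<le> c * \<bar>y - t\<bar>"
    using assms(2) by blast
  then have "norm (f (t + s) - f t - s *\<^sub>R e) \<le> c * \<bar>s\<bar>" if "\<bar>s\<bar> < h" for s
    using that by (auto dest!: spec[of _ "t + s"])
  with \<open>h > 0\<close> show ?thesis
    by blast
qed

text \<open>Near \<open>t\<close> the curve follows its tangent, and the parameters with values in
  the percolation set leave only gaps small relative to the distance from \<open>t\<close>. Each of
  the \<open>W\<close> points on the tangent segment is thus approximated by a point of the set,
  with an error below the cube size once \<open>n\<close> is large.\<close>

lemma eventually_aligned_on_curve:
  fixes \<gamma> :: "real \<Rightarrow> real ^ 'd"
  assumes N: "N \<ge> 2" and W: "W > 0" and L: "L-lipschitz_on UNIV \<gamma>"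
    and \<gamma>: "(\<gamma> has_vector_derivative e) (at t)" "e \<noteq> 0"
    and t: "\<gamma> t \<in> percolation_set N \<omega>"
    and gaps: "((\<lambda>s. infdist s {r. \<gamma> r \<in> percolation_set N \<omega>}) has_vector_derivative 0) (at t)"
  shows "\<exists>n0. \<forall>n\<ge>n0. aligned N W n (cell N n (\<gamma> t)) \<omega>"
proof -
  let ?E = "percolation_set N \<omega>"
  let ?K = "{r. \<gamma> r \<in> ?E}"
  have L0: "0 \<le> L"
    using L by (rule lipschitz_on_nonneg)
  have "Max (range (\<lambda>i. \<bar>e $ i\<bar>)) \<in> range (\<lambda>i. \<bar>e $ i\<bar>)"
    by (intro Max_in) auto
  then obtain i0 where "Max (range (\<lambda>i. \<bar>e $ i\<bar>)) = \<bar>e $ i0\<bar>"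
    by (rule rangeE)
  then have i0: "\<bar>e $ i\<bar> \<le> \<bar>e $ i0\<bar>" for i
    using Max_ge[of "range (\<lambda>i. \<bar>e $ i\<bar>)" "\<bar>e $ i\<bar>"] by auto
  define m where "m = \<bar>e $ i0\<bar>"
  have m: "m > 0"
  proof (rule ccontr)
    assume "\<not> ?thesis"
    then have "e $ i = 0" for i
      using i0[of i] by (simp add: m_def)
    with \<gamma>(2) show False by (simp add: vec_eq_iff)
  qed
  define u where "u = (1 / m) *\<^sub>R e"
  have u: "\<bar>u $ i\<bar> \<le> 1" "\<bar>u $ i0\<bar> = 1" for i
    using i0[of i] m by (auto simp: u_def m_def)
  \<comment> \<open>The total error at parameter distance \<open>s\<close> is at most
    \<open>c * (2 * L + 1) * s\<close>: \<open>2 * L\<close> from moving to a parameter in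
    \<open>?K\<close>, \<open>1\<close> from linearising. This \<open>c\<close> makes it at most
    \<open>1 / real N ^ n\<close> up to the largest \<open>s\<close> used,
    \<open>11 * real W / (m * real N ^ n)\<close>.\<close>
  define c where "c = m / (11 * real W * (2 * L + 1))"
  have c: "c > 0"
    using m W L0 by (simp add: c_def)
  obtain h1 where h1: "h1 > 0" "\<And>s. \<bar>s\<bar> < h1 \<Longrightarrow> norm (\<gamma> (t + s) - \<gamma> t - s *\<^sub>R e) \<le> c * \<bar>s\<bar>"
    using has_vector_derivative_increment[OF \<gamma>(1) c] by blast
  obtain h2 where h2: "h2 > 0" "\<And>s. \<bar>s\<bar> < h2 \<Longrightarrow> infdist (t + s) ?K \<le> c * \<bar>s\<bar>"
    using has_vector_derivative_increment[OF gaps c] t by (auto simp: infdist_nonneg)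
  have "(\<lambda>n. 11 * real W / m * (1 / real N) ^ n) \<longlonglongrightarrow> 11 * real W / m * 0"
    using N by (intro tendsto_mult tendsto_const LIMSEQ_power_zero) auto
  then have "eventually (\<lambda>n. 11 * real W / m * (1 / real N) ^ n < min h1 h2) sequentially"
    using h1(1) h2(1) by (intro order_tendstoD) auto
  then obtain n0 where n0: "\<And>n. n \<ge> n0 \<Longrightarrow> 11 * real W / m * (1 / real N) ^ n < min h1 h2"
    by (auto simp: eventually_sequentially)
  have "aligned N W n (cell N n (\<gamma> t)) \<omega>" if n: "n \<ge> n0" for n
  proof (rule aligned_if_near_segment[OF N W u])
    fix w assume w: "w < W"
    define \<rho> where "\<rho> = 1 / real N ^ n"
    \<comment> \<open>Chosen so that \<open>s *\<^sub>R e\<close> is the displacement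
      \<open>11 * w * \<rho>\<close> along \<open>u\<close>.\<close>
    define s where "s = 11 * real w * \<rho> / m"
    have \<rho>: "\<rho> > 0"
      using N by (simp add: \<rho>_def)
    have "11 * real w * \<rho> \<le> 11 * real W * \<rho>"
      using w \<rho> by simp
    then have s: "0 \<le> s" "s \<le> 11 * real W * \<rho> / m"
      using m \<rho> by (auto simp: s_def intro!: divide_right_mono)
    have "11 * real W * \<rho> / m < min h1 h2"
      using n0[OF n] by (simp add: \<rho>_def power_one_over field_simps)
    with s have sh: "\<bar>s\<bar> < h1" "\<bar>s\<bar> < h2"
      by auto
    \<comment> \<open>The factor \<open>2\<close> makes the inequality strict, so a parameter that
      close exists even if the infimum is not attained. For \<open>s = 0\<close> there is no such
      room, and \<open>t\<close> itself serves.\<close>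
    obtain k where k: "\<gamma> k \<in> ?E" "dist (t + s) k \<le> 2 * c * s"
    proof (cases "s = 0")
      case True
      then show thesis
        using t by (intro that[of t]) auto
    next
      case False
      then have "infdist (t + s) ?K < 2 * c * s"
        using h2(2)[OF sh(2)] s(1) mult_pos_pos[OF c, of s] by simp
      moreover have ne: "?K \<noteq> {}"
        using t by auto
      ultimately have "Inf (dist (t + s) ` ?K) < 2 * c * s"
        by (simp only: infdist_notempty[OF ne])
      then obtain k where "k \<in> ?K" "dist (t + s) k < 2 * c * s"
        using cInf_lessD[of "dist (t + s) ` ?K"] ne by blast
      then show thesis
        by (intro that[of k]) auto
    qed
    have "norm (\<gamma> k - \<gamma> t - s *\<^sub>R e) \<le> norm (\<gamma> k - \<gamma> (t + s)) + norm (\<gamma> (t + s) - \<gamma> t - s *\<^sub>R e)"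
      using norm_triangle_ineq[of "\<gamma> k - \<gamma> (t + s)" "\<gamma> (t + s) - \<gamma> t - s *\<^sub>R e"]
      by (simp add: algebra_simps)
    also have "\<dots> \<le> L * (2 * c * s) + c * s"
    proof (intro add_mono)
      have "dist (\<gamma> k) (\<gamma> (t + s)) \<le> L * dist k (t + s)"
        using lipschitz_onD[OF L] by simp
      also have "\<dots> \<le> L * (2 * c * s)"
        using k(2) L0 by (intro mult_left_mono) (simp_all add: dist_commute)
      finally show "norm (\<gamma> k - \<gamma> (t + s)) \<le> L * (2 * c * s)"
        by (simp add: dist_norm)
      show "norm (\<gamma> (t + s) - \<gamma> t - s *\<^sub>R e) \<le> c * s"
        using h1(2)[OF sh(1)] s(1) by simp
    qed
    also have "\<dots> = c * (2 * L + 1) * s"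
      by (simp add: algebra_simps)
    also have "\<dots> \<le> c * (2 * L + 1) * (11 * real W * \<rho> / m)"
      using s(2) c L0 by (intro mult_left_mono) auto
    also have "c * (2 * L + 1) = m / (11 * real W)"
      using L0 by (simp add: c_def)
    also have "m / (11 * real W) * (11 * real W * \<rho> / m) = \<rho>"
      using m W by simp
    finally have "norm (\<gamma> k - \<gamma> t - s *\<^sub>R e) \<le> \<rho>" .
    then have "\<bar>(\<gamma> k - \<gamma> t - s *\<^sub>R e) $ i\<bar> \<le> \<rho>" for i
      using component_le_norm_cart[of "\<gamma> k - \<gamma> t - s *\<^sub>R e" i] by linarith
    moreover have "(\<gamma> k - \<gamma> t - s *\<^sub>R e) $ i = \<gamma> k $ i - \<gamma> t $ i - 11 * real w / real N ^ n * u $ i" for i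
      by (simp add: s_def u_def \<rho>_def)
    ultimately show "\<exists>z\<in>?E. \<forall>i. \<bar>z $ i - \<gamma> t $ i - 11 * real w / real N ^ n * u $ i\<bar> \<le> 1 / real N ^ n"
      using k(1) unfolding \<rho>_def by auto
  qed
  then show ?thesis by blast
qed

section \<open>From non-alignment to pure unrectifiability\<close>

lemma percolation_set_subset_unit_cube:
  assumes "N > 0" "x \<in> percolation_set N \<omega>"
  shows "0 \<le> x $ i \<and> x $ i \<le> 1"
proof -
  \<comment> \<open>The unit cube is the only grid cube of level \<open>0\<close>.\<close>
  obtain Q where "Q \<in> chosen_cubes N \<omega> 0" "x \<in> Q"
    using assms(2) by (auto simp: percolation_set_def)
  then obtain l where "\<forall>i. l i = Suc 0" "x \<in> grid_cube N 0 l"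
    by (auto simp: chosen_cubes_def grid_cubes_eq)
  then show ?thesis
    using assms(1) by (simp add: mem_grid_cube)
qed

text \<open>The assumption \<open>na\<close> does not mention a curve, so a single null set of
  labellings serves all Lipschitz maps at once.\<close>

lemma purely_unrectifiable_if_not_aligned:
  fixes \<omega> :: "(real ^ 'd::finite) set \<Rightarrow> bool"
  assumes N: "N \<ge> 2" and W: "W > 0"
    and na: "\<And>n0 x. (\<forall>i. 0 \<le> x $ i \<and> x $ i \<le> 1) \<Longrightarrow> \<exists>n\<ge>n0. \<not> aligned N W n (cell N n x) \<omega>"
  shows "purely_unrectifiable TYPE(1) (percolation_set N \<omega>)"
  unfolding purely_unrectifiable_def
proof (intro allI impI)
  fix f :: "real ^ 1 \<Rightarrow> real ^ 'd"
  assume "\<exists>L. L-lipschitz_on UNIV f"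
  then obtain L where L: "L-lipschitz_on UNIV f" ..
  let ?E = "percolation_set N \<omega>"
  define \<gamma> where "\<gamma> r = f (vec r)" for r :: real
  have \<gamma>L: "L-lipschitz_on UNIV \<gamma>"
  proof (rule lipschitz_onI)
    show "dist (\<gamma> r) (\<gamma> s) \<le> L * dist r s" for r s
      using lipschitz_onD[OF L, of "vec r" "vec s"] by (simp add: \<gamma>_def dist_norm norm_vector_1)
  qed (rule lipschitz_on_nonneg[OF L])
  have "vec (x $ 1) = x" for x :: "real ^ 1"
    by (simp add: vec_eq_iff forall_1)
  then have range: "range f = range \<gamma>"
    unfolding \<gamma>_def by (metis (mono_tags, lifting) rangeI image_subsetI subset_antisym)
  define K where "K = {r. \<gamma> r \<in> ?E}"
  \<comment> \<open>Parameters outside \<open>B\<close> and \<open>Z\<close> with value in the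
    percolation set would be eventually aligned, against \<open>na\<close>. So \<open>K\<close> is
    covered by the negligible set \<open>B\<close> and the critical set \<open>Z\<close>, whose
    images are null for different reasons.\<close>
  define B where "B = (\<Union>b\<in>Basis. {t. \<not> (\<lambda>r. \<gamma> r \<bullet> b) differentiable at t}) \<union> {t. \<not> (\<lambda>s. infdist s K) differentiable at t}"
  define Z where "Z = {t. (\<gamma> has_vector_derivative 0) (at t)}"
  have "negligible {t. \<not> (\<lambda>r. \<gamma> r \<bullet> b) differentiable at t}" if "b \<in> Basis" for b
  proof (rule lipschitz_differentiable_ae[of L], rule lipschitz_onI)
    fix r s
    have "dist (\<gamma> r \<bullet> b) (\<gamma> s \<bullet> b) = \<bar>(\<gamma> r - \<gamma> s) \<bullet> b\<bar>"
      by (simp add: dist_real_def inner_diff_left)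
    also have "\<dots> \<le> dist (\<gamma> r) (\<gamma> s)"
      unfolding dist_norm using that by (rule Basis_le_norm)
    also have "\<dots> \<le> L * dist r s"
      using lipschitz_onD[OF \<gamma>L] by simp
    finally show "dist (\<gamma> r \<bullet> b) (\<gamma> s \<bullet> b) \<le> L * dist r s" .
  qed (rule lipschitz_on_nonneg[OF L])
  moreover have "negligible {t. \<not> (\<lambda>s. infdist s K) differentiable at t}"
    by (rule lipschitz_differentiable_ae[of 1], rule lipschitz_onI)
      (auto simp: dist_real_def[of "infdist _ _"] infdist_triangle_abs)
  ultimately have B: "negligible B"
    unfolding B_def by (intro negligible_Un negligible_Union) auto
  have KBZ: "t \<in> B \<or> t \<in> Z" if t: "t \<in> K" for t
  proof (rule ccontr)
    assume "\<not> (t \<in> B \<or> t \<in> Z)"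
    then have d: "\<gamma> differentiable at t" "(\<lambda>s. infdist s K) differentiable at t" and "t \<notin> Z"
      by (auto simp: B_def differentiable_componentwise_within[of \<gamma>])
    then obtain e where e: "(\<gamma> has_vector_derivative e) (at t)"
      using vector_derivative_works by blast
    with \<open>t \<notin> Z\<close> have "e \<noteq> 0"
      by (auto simp: Z_def)
    have tE: "\<gamma> t \<in> ?E"
      using t by (simp add: K_def)
    obtain n0 where "\<forall>n\<ge>n0. aligned N W n (cell N n (\<gamma> t)) \<omega>"
      using eventually_aligned_on_curve[OF N W \<gamma>L e \<open>e \<noteq> 0\<close> tE]
        has_derivative_infdist_zero[OF d(2) t] unfolding K_def by blast
    moreover have "\<forall>i. 0 \<le> \<gamma> t $ i \<and> \<gamma> t $ i \<le> 1"
      using percolation_set_subset_unit_cube[OF _ tE] N by auto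
    ultimately show False
      using na by blast
  qed
  \<comment> \<open>One sequence interleaves both sets and cuts them to bounded intervals, as the
    two image lemmas require.\<close>
  define A where "A n = \<gamma> ` ((if even n then Z else B) \<inter> {- real n..real n})" for n
  have "hausdorff_measure 1 (A n) = 0" for n
  proof (cases "even n")
    case True
    show ?thesis
      unfolding A_def if_P[OF True]
      by (rule hausdorff_measure_1_image_zero_derivative[of _ "- real n" "real n"]) (auto simp: Z_def)
  next
    case False
    show ?thesis
      unfolding A_def if_not_P[OF False]
      by (rule hausdorff_measure_1_image_negligible[OF \<gamma>L, of _ "- real n" "real n"])
        (auto intro: negligible_subset[OF B])
  qed
  then have null: "hausdorff_measure 1 (\<Union>n. A n) = 0"
    by (rule hausdorff_measure_UN_null)
  have "range f \<inter> ?E \<subseteq> (\<Union>n. A n)"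
  proof
    fix x assume "x \<in> range f \<inter> ?E"
    then obtain t where t: "x = \<gamma> t" "t \<in> K"
      unfolding range by (auto simp: K_def)
    obtain j where j: "\<bar>t\<bar> \<le> real j"
      using real_arch_simple by blast
    have "x \<in> A (2 * j) \<or> x \<in> A (2 * j + 1)"
      using KBZ[OF t(2)] j unfolding t(1) A_def by (elim disjE) (auto intro!: imageI)
    then show "x \<in> (\<Union>n. A n)" by blast
  qed
  then have "hausdorff_measure 1 (range f \<inter> ?E) \<le> hausdorff_measure 1 (\<Union>n. A n)"
    by (rule hausdorff_measure_mono)
  then show "hausdorff_measure CARD(1) (range f \<inter> ?E) = 0"
    unfolding null by simp
qed

theorem theorem4p17:
  fixes N :: nat and p :: real
  assumes "CARD('d::finite) \<ge> 2" and "N \<ge> 2" and "0 \<le> p" and "p < 1"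
  shows "AE \<omega> in (percolation_measure N p :: ((real ^ 'd) set \<Rightarrow> bool) measure).
           purely_unrectifiable TYPE(1) (percolation_set N \<omega>)"
proof -
  obtain W where W: "W > 0"
    "AE \<omega> in (label_measure N p :: ((real ^ 'd) set \<Rightarrow> bool) measure).
      \<forall>n0 x. (\<forall>i. 0 \<le> x $ i \<and> x $ i \<le> 1) \<longrightarrow> (\<exists>n\<ge>n0. \<not> aligned N W n (cell N n x) \<omega>)"
    using AE_not_always_aligned[OF assms(2-4)] by blast
  have "AE \<omega> in (label_measure N p :: ((real ^ 'd) set \<Rightarrow> bool) measure).
      purely_unrectifiable TYPE(1) (percolation_set N \<omega>)"
    using W(2) by eventually_elim (intro purely_unrectifiable_if_not_aligned[OF assms(2) W(1)], blast)
  then show ?thesis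
    unfolding percolation_measure_def by (rule AE_completion)
qed

end
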